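(* Let $d \geq 2$ and consider site percolation on $\mathbb{Z}^d$ at its critical probability $p_c = p_c(d)$. There is a constant $c'>0$, which depends only on the dimension $d$, such that for all $n \geq 1$ and all $x, y \in \Lambda(n)$, $$\mathbb{P}_{p_c}\bigl(x \leftrightarrow y \text{ in } \Lambda(9n)\bigr) \geq \frac{c'}{n^{d^2}}.$$
   Context: $\mathbb{Z}^d$ is viewed as a graph in which $v,w$ are neighbours iff $\sum_{i=1}^d |v_i-w_i|=1$. In site percolation with parameter $p\in[0,1]$ each vertex is independently open with probability $p$ and closed otherwise; $\mathbb{P}_p$ is the resulting probability measure. The critical probability is $p_c=p_c(d)=\sup\{p : \mathbb{P}_p(\text{there is an infinite connected set of open vertices})=0\}$. For an integer $n\ge 1$, $\Lambda(n):=[-n,n]^d$, and $x,y\in\Lambda(n)$ are lattice points (elements of $\mathbb{Z}^d$). A path is a finite sequence of vertices $v(1),\dots,v(k)$ with $\sum_{l}|v(i+1)_l-v(i)_l|\le 1$ for all $1\le i\le k-1$; it is open if all its vertices are open. The event $\{x \leftrightarrow y \text{ in } \Lambda(9n)\}$ is the event that there is an open path from $x$ to $y$ all of whose vertices lie in $\Lambda(9n)$. *)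

theory Defs
  imports "HOL-Probability.Probability"
begin

text \<open>
  Vertices of the lattice \<open>\<int>\<^sup>d\<close> are vectors of type \<open>int ^ 'd\<close>, where \<open>d = CARD('d)\<close>.
\<close>

definition l1_dist :: "int ^ 'd \<Rightarrow> int ^ 'd \<Rightarrow> int" where
  "l1_dist v w = (\<Sum>i\<in>UNIV. \<bar>v $ i - w $ i\<bar>)"

text \<open>
  Consecutive vertices of a path are equal or neighbours; repetitions are allowed.
\<close>

definition lattice_path :: "(int ^ 'd) list \<Rightarrow> bool" where
  "lattice_path v \<longleftrightarrow>
     v \<noteq> [] \<and> (\<forall>i. Suc i < length v \<longrightarrow> l1_dist (v ! Suc i) (v ! i) \<le> 1)"

definition joined_in :: "(int ^ 'd) set \<Rightarrow> int ^ 'd \<Rightarrow> int ^ 'd \<Rightarrow> bool" where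
  "joined_in S x y \<longleftrightarrow> (\<exists>v. lattice_path v \<and> hd v = x \<and> last v = y \<and> set v \<subseteq> S)"

definition lattice_connected :: "(int ^ 'd) set \<Rightarrow> bool" where
  "lattice_connected S \<longleftrightarrow> (\<forall>x\<in>S. \<forall>y\<in>S. joined_in S x y)"

definition lattice_box :: "nat \<Rightarrow> (int ^ 'd) set" where
  "lattice_box n = {x. \<forall>i. - int n \<le> x $ i \<and> x $ i \<le> int n}"

text \<open>
  A configuration \<open>\<omega>\<close> assigns \<open>True\<close> to the open vertices and \<open>False\<close> to the closed ones.
  The product measure below is meant for \<open>0 \<le> p \<le> 1\<close> only.
\<close>

definition site_percolation :: "real \<Rightarrow> (int ^ 'd \<Rightarrow> bool) measure" where
  "site_percolation p = PiM UNIV (\<lambda>_. measure_pmf (bernoulli_pmf p))"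

definition open_vertices :: "(int ^ 'd \<Rightarrow> bool) \<Rightarrow> (int ^ 'd) set" where
  "open_vertices \<omega> = {v. \<omega> v}"

definition infinite_cluster_event :: "(int ^ 'd \<Rightarrow> bool) set" where
  "infinite_cluster_event =
     {\<omega>. \<exists>S. infinite S \<and> lattice_connected S \<and> S \<subseteq> open_vertices \<omega>}"

definition critical_probability :: "'d::finite itself \<Rightarrow> real" where
  "critical_probability _ =
     Sup {p. 0 \<le> p \<and> p \<le> 1 \<and>
             measure (site_percolation p) (infinite_cluster_event :: (int ^ 'd \<Rightarrow> bool) set) = 0}"

definition connection_event ::
    "int ^ 'd \<Rightarrow> int ^ 'd \<Rightarrow> (int ^ 'd) set \<Rightarrow> (int ^ 'd \<Rightarrow> bool) set" where
  "connection_event x y A = {\<omega>. joined_in (open_vertices \<omega> \<inter> A) x y}"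

end

theory Submission
  imports Defs
begin

text \<open>
  For a finite set \<open>W\<close> containing the origin, let \<open>exit_mean p W\<close> be the mean number of vertices on the
  outer boundary of \<open>W\<close> that are adjacent to the cluster of the origin inside \<open>W\<close>. If this number is
  below \<open>1\<close>, exploring clusters of translates of \<open>W\<close> one after the other gives exponential decay, hence no
  infinite cluster; by continuity in \<open>p\<close> it is therefore at least \<open>1\<close> at the critical point. Apply this to
  the component \<open>W\<close> of the origin in the set \<open>S\<close> of those \<open>y\<close> in the box of radius \<open>m\<close> that are joined to
  the origin inside the box with probability at least \<open>p / (3 m)\<^sup>d\<close>. If \<open>W\<close> did not reach the faces of the
  box, its boundary would contain at most \<open>(3 m)\<^sup>d\<close> vertices, all outside \<open>S\<close>, and so \<open>p \<cdot> exit_mean p W < p\<close>, a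
  contradiction. So \<open>S\<close> contains a lattice curve from the origin to a face of the box, and \<open>S\<close> is
  invariant under permutations and sign changes of the coordinates.

  Permute coordinates to get \<open>d\<close> curves \<open>g\<^sub>1, \<dots>, g\<^sub>d\<close> such that the \<open>j\<close>-th coordinate of \<open>g\<^sub>j\<close> sweeps
  from \<open>0\<close> to \<open>\<plusminus>m\<close>. To write a vector \<open>v\<close> of sup norm at most \<open>m\<close> as a sum of one point from each curve,
  the signs of all coordinates being free, fold in each coordinate \<open>j\<close> the contributions of the other
  curves: \<open>\<bar>\<dots>\<bar>\<bar>v\<^sub>j\<bar> - \<bar>g\<^sub>1\<^sub>j\<bar>\<bar> - \<dots>\<bar>\<close> is a continuous function of the times with values in \<open>[0, m]\<close>, and it
  has to equal \<open>\<bar>g\<^sub>j\<^sub>j\<bar>\<close>. Simultaneous solvability is the Poincare--Miranda theorem, here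
  in the discrete form of Kuhn's lemma with an error of at most \<open>d\<close>. Taking \<open>m = 2 n\<close> and \<open>v = y - x\<close>, Harris'
  inequality along the \<open>d\<close> steps gives a lower bound of order \<open>(n\<^sup>-\<^sup>d)\<^sup>d\<close>.
\<close>

section \<open>Finite product measures\<close>

text \<open>The probability that the set \<open>U\<close> of open elements of \<open>F\<close> satisfies \<open>P\<close>, as an explicit polynomial in \<open>p\<close>.\<close>

definition cyl :: "real \<Rightarrow> 'a set \<Rightarrow> ('a set \<Rightarrow> bool) \<Rightarrow> real" where
  "cyl p F P = (\<Sum>U\<in>Pow F. of_bool (P U) * (p ^ card U * (1 - p) ^ card (F - U)))"

lemma cyl_empty [simp]: "cyl p {} P = of_bool (P {})"
  by (simp add: cyl_def)

text \<open>Conditioning on the state of \<open>v\<close>; this recursion drives the inductions over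
  \<open>F\<close> below.\<close>

lemma cyl_insert:
  assumes "finite F" "v \<notin> F"
  shows "cyl p (insert v F) P = p * cyl p F (\<lambda>U. P (insert v U)) + (1 - p) * cyl p F P"
proof -
  have disj: "Pow F \<inter> insert v ` Pow F = {}"
    using assms by auto
  have inj: "inj_on (insert v) (Pow F)"
    using assms by (auto simp: inj_on_def)
  have 1: "(\<Sum>U\<in>insert v ` Pow F. of_bool (P U) * (p ^ card U * (1 - p) ^ card (insert v F - U)))
     = p * cyl p F (\<lambda>U. P (insert v U))"
    unfolding cyl_def sum.reindex[OF inj] sum_distrib_left
  proof (rule sum.cong[OF refl])
    fix U assume "U \<in> Pow F"
    then have U: "U \<subseteq> F" "finite U" "v \<notin> U"
      using assms finite_subset by auto
    have "insert v F - insert v U = F - U"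
      using assms U by auto
    then show "((\<lambda>U. of_bool (P U) * (p ^ card U * (1 - p) ^ card (insert v F - U))) \<circ> insert v) U =
       p * (of_bool (P (insert v U)) * (p ^ card U * (1 - p) ^ card (F - U)))"
      using U by simp
  qed
  have 2: "(\<Sum>U\<in>Pow F. of_bool (P U) * (p ^ card U * (1 - p) ^ card (insert v F - U)))
     = (1 - p) * cyl p F P"
    unfolding cyl_def sum_distrib_left
  proof (rule sum.cong[OF refl])
    fix U assume "U \<in> Pow F"
    then have U: "U \<subseteq> F" "finite U" "v \<notin> U"
      using assms finite_subset by auto
    have "insert v F - U = insert v (F - U)"
      using U by auto
    then have "card (insert v F - U) = Suc (card (F - U))"
      using assms U by simp
    then show "of_bool (P U) * (p ^ card U * (1 - p) ^ card (insert v F - U)) =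
       (1 - p) * (of_bool (P U) * (p ^ card U * (1 - p) ^ card (F - U)))"
      by simp
  qed
  show ?thesis
    unfolding cyl_def[of p "insert v F"] Pow_insert
    using assms disj 1 2 by (subst sum.union_disjoint) auto
qed

lemma cyl_cong:
  assumes "\<And>U. U \<subseteq> F \<Longrightarrow> P U = Q U"
  shows "cyl p F P = cyl p F Q"
  unfolding cyl_def using assms by (intro sum.cong) auto

lemma cyl_True [simp]:
  assumes "finite F"
  shows "cyl p F (\<lambda>_. True) = 1"
  using assms by (induction F rule: finite_induct) (simp_all add: cyl_insert)

lemma cyl_False [simp]: "cyl p F (\<lambda>_. False) = 0"
  by (simp add: cyl_def)

lemma cyl_mono:
  assumes "0 \<le> p" "p \<le> 1" "\<And>U. U \<subseteq> F \<Longrightarrow> P U \<Longrightarrow> Q U"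
  shows "cyl p F P \<le> cyl p F Q"
  unfolding cyl_def using assms
  by (intro sum_mono mult_right_mono) auto

lemma cyl_nonneg:
  assumes "0 \<le> p" "p \<le> 1"
  shows "0 \<le> cyl p F P"
  unfolding cyl_def using assms by (intro sum_nonneg) auto

lemma cyl_le_1:
  assumes "0 \<le> p" "p \<le> 1" "finite F"
  shows "cyl p F P \<le> 1"
  using cyl_mono[of p F P "\<lambda>_. True"] assms by simp

lemma continuous_on_cyl: "continuous_on S (\<lambda>p. cyl p F P)"
  unfolding cyl_def by (intro continuous_intros)

text \<open>Independence of the states on disjoint vertex sets. \<open>P\<close> stays arbitrary in
  the induction because opening \<open>v\<close> replaces it by
  \<open>\<lambda>W. P (insert v W)\<close>.\<close>

lemma cyl_Un:
  assumes "finite F" "finite G" "F \<inter> G = {}"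
  shows "cyl p (F \<union> G) (\<lambda>U. P (U \<inter> F) \<and> Q (U \<inter> G)) = cyl p F P * cyl p G Q"
  using assms(1,3)
proof (induction F arbitrary: P rule: finite_induct)
  case empty
  have "cyl p G (\<lambda>U. P {} \<and> Q (U \<inter> G)) = cyl p G (\<lambda>U. P {} \<and> Q U)"
    by (rule cyl_cong) (simp add: Int_absorb2)
  then show ?case
    by (cases "P {}") simp_all
next
  case (insert v F)
  have v: "v \<notin> F \<union> G" and fin: "finite (F \<union> G)"
    using insert assms by auto
  have "cyl p (F \<union> G) (\<lambda>U. P (insert v U \<inter> insert v F) \<and> Q (insert v U \<inter> G)) =
        cyl p (F \<union> G) (\<lambda>U. P (insert v (U \<inter> F)) \<and> Q (U \<inter> G))"
  proof (rule cyl_cong)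
    fix U
    have "insert v U \<inter> insert v F = insert v (U \<inter> F)" "insert v U \<inter> G = U \<inter> G"
      using v by auto
    then show "(P (insert v U \<inter> insert v F) \<and> Q (insert v U \<inter> G)) = (P (insert v (U \<inter> F)) \<and> Q (U \<inter> G))"
      by simp
  qed
  moreover have "cyl p (F \<union> G) (\<lambda>U. P (U \<inter> insert v F) \<and> Q (U \<inter> G)) =
        cyl p (F \<union> G) (\<lambda>U. P (U \<inter> F) \<and> Q (U \<inter> G))"
  proof (rule cyl_cong)
    fix U assume "U \<subseteq> F \<union> G"
    then have "U \<inter> insert v F = U \<inter> F"
      using v by auto
    then show "(P (U \<inter> insert v F) \<and> Q (U \<inter> G)) = (P (U \<inter> F) \<and> Q (U \<inter> G))"
      by simp
  qed
  ultimately show ?case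
    using v fin insert.hyps insert.prems insert.IH[of P] insert.IH[of "\<lambda>W. P (insert v W)"]
    by (simp add: cyl_insert algebra_simps)
qed

lemma cyl_restrict:
  assumes "finite G" "F \<subseteq> G"
  shows "cyl p G (\<lambda>U. P (U \<inter> F)) = cyl p F P"
proof -
  have "cyl p (F \<union> (G - F)) (\<lambda>U. P (U \<inter> F) \<and> True) = cyl p F P * cyl p (G - F) (\<lambda>_. True)"
    using assms by (intro cyl_Un) (auto intro: finite_subset)
  moreover have "F \<union> (G - F) = G"
    using assms by auto
  ultimately show ?thesis
    using assms by simp
qed

lemma cyl_subset_mono:
  assumes "0 \<le> p" "p \<le> 1" "finite G" "F \<subseteq> G" "\<And>U V. U \<subseteq> V \<Longrightarrow> V \<subseteq> G \<Longrightarrow> P U \<Longrightarrow> P V"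
  shows "cyl p F P \<le> cyl p G P"
proof -
  have "cyl p F P = cyl p G (\<lambda>U. P (U \<inter> F))"
    using assms by (simp add: cyl_restrict)
  also have "\<dots> \<le> cyl p G P"
    using assms(5) by (intro cyl_mono assms(1,2)) (meson inf_le1)
  finally show ?thesis .
qed

lemma cyl_all_open:
  assumes "finite F"
  shows "cyl p F (\<lambda>U. F \<subseteq> U) = p ^ card F"
proof -
  have "cyl p F (\<lambda>U. F \<subseteq> U) = (\<Sum>U\<in>Pow F. if U = F then p ^ card F else 0)"
    unfolding cyl_def by (intro sum.cong) auto
  then show ?thesis
    using assms by simp
qed

lemma cyl_image:
  assumes "inj_on f F"
  shows "cyl p (f ` F) P = cyl p F (\<lambda>U. P (f ` U))"
proof -
  have inj: "inj_on ((`) f) (Pow F)"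
    using assms by (rule inj_on_image_Pow)
  have "card (f ` U) = card U" "card (f ` F - f ` U) = card (F - U)" if "U \<subseteq> F" for U
  proof -
    show "card (f ` U) = card U"
      using that assms by (meson card_image inj_on_subset)
    have "f ` F - f ` U = f ` (F - U)"
      using that assms by (simp add: inj_on_image_set_diff[of f F F U])
    then show "card (f ` F - f ` U) = card (F - U)"
      using assms by (metis Diff_subset card_image inj_on_subset)
  qed
  then show ?thesis
    unfolding cyl_def image_Pow_surj[OF refl, of f F, symmetric] sum.reindex[OF inj]
    by (intro sum.cong) auto
qed

text \<open>For each state of \<open>v\<close> the induction hypothesis applies; what is left is
  Chebyshev's inequality for two increasing functions of one bit.\<close>

lemma harris_inequality:
  assumes "0 \<le> p" "p \<le> 1" "finite F"
    and "\<And>U V. U \<subseteq> V \<Longrightarrow> V \<subseteq> F \<Longrightarrow> P U \<Longrightarrow> P V"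
    and "\<And>U V. U \<subseteq> V \<Longrightarrow> V \<subseteq> F \<Longrightarrow> Q U \<Longrightarrow> Q V"
  shows "cyl p F P * cyl p F Q \<le> cyl p F (\<lambda>U. P U \<and> Q U)"
  using assms(3-)
proof (induction F arbitrary: P Q rule: finite_induct)
  case empty
  then show ?case by simp
next
  case (insert v F)
  note mP = insert.prems(1) and mQ = insert.prems(2)
  define a where "a = cyl p F (\<lambda>U. P (insert v U))"
  define b where "b = cyl p F P"
  define c where "c = cyl p F (\<lambda>U. Q (insert v U))"
  define d where "d = cyl p F Q"
  have ab: "b \<le> a"
    unfolding a_def b_def
  proof (rule cyl_mono[OF assms(1,2)])
    fix U assume "U \<subseteq> F" "P U"
    then show "P (insert v U)" using mP[of U "insert v U"] by blast
  qed
  have cd: "d \<le> c"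
    unfolding c_def d_def
  proof (rule cyl_mono[OF assms(1,2)])
    fix U assume "U \<subseteq> F" "Q U"
    then show "Q (insert v U)" using mQ[of U "insert v U"] by blast
  qed
  have 1: "a * c \<le> cyl p F (\<lambda>U. P (insert v U) \<and> Q (insert v U))"
    unfolding a_def c_def
  proof (rule insert.IH)
    fix U V assume "U \<subseteq> V" "V \<subseteq> F"
    then have *: "insert v U \<subseteq> insert v V" "insert v V \<subseteq> insert v F" by auto
    show "P (insert v U) \<Longrightarrow> P (insert v V)" "Q (insert v U) \<Longrightarrow> Q (insert v V)"
      using mP[OF *] mQ[OF *] by auto
  qed
  have 2: "b * d \<le> cyl p F (\<lambda>U. P U \<and> Q U)"
    unfolding b_def d_def
  proof (rule insert.IH)
    fix U V assume "U \<subseteq> V" "V \<subseteq> F"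
    then have *: "U \<subseteq> V" "V \<subseteq> insert v F" by auto
    show "P U \<Longrightarrow> P V" "Q U \<Longrightarrow> Q V"
      using mP[OF *] mQ[OF *] by auto
  qed
  \<comment> \<open>This product is the covariance, \<open>p * (a * c) + (1 - p) * (b * d)\<close>
    minus the product of the two means.\<close>
  have "0 \<le> (p * (1 - p)) * ((a - b) * (c - d))"
    using assms ab cd by simp
  then have "(p * a + (1 - p) * b) * (p * c + (1 - p) * d) \<le> p * (a * c) + (1 - p) * (b * d)"
    by (simp add: algebra_simps power2_eq_square)
  also have "\<dots> \<le> p * cyl p F (\<lambda>U. P (insert v U) \<and> Q (insert v U)) + (1 - p) * cyl p F (\<lambda>U. P U \<and> Q U)"
    using 1 2 assms by (intro add_mono mult_left_mono) auto
  finally show ?case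
    using insert by (simp add: cyl_insert a_def b_def c_def d_def)
qed

section \<open>The percolation measure on events of finitely many vertices\<close>

lemma space_site_percolation [simp]: "space (site_percolation p) = UNIV"
  by (simp add: site_percolation_def space_PiM)

lemma prob_space_site_percolation: "prob_space (site_percolation p)"
  unfolding site_percolation_def by (intro prob_space_PiM prob_space_measure_pmf)

lemma site_percolation_cylinder:
  assumes "finite F" "U \<subseteq> F" "0 \<le> p" "p \<le> 1"
  shows "{\<omega>. open_vertices \<omega> \<inter> F = U} \<in> sets (site_percolation p)"
    and "measure (site_percolation p) {\<omega>. open_vertices \<omega> \<inter> F = U} = p ^ card U * (1 - p) ^ card (F - U)"
proof -
  interpret product_prob_space "\<lambda>_. measure_pmf (bernoulli_pmf p)" UNIV
    by unfold_locales
  have eq: "{\<omega>. open_vertices \<omega> \<inter> F = U} = prod_emb UNIV (\<lambda>_. measure_pmf (bernoulli_pmf p)) F (\<Pi>\<^sub>E v\<in>F. {v \<in> U})"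
    using assms(2) by (auto simp: prod_emb_def open_vertices_def PiE_iff restrict_def fun_eq_iff extensional_def)
  show "{\<omega>. open_vertices \<omega> \<inter> F = U} \<in> sets (site_percolation p)"
    unfolding eq site_percolation_def using assms by (intro sets_PiM_I) auto
  have "measure (site_percolation p) {\<omega>. open_vertices \<omega> \<inter> F = U} = (\<Prod>v\<in>F. measure (measure_pmf (bernoulli_pmf p)) {v \<in> U})"
    unfolding eq site_percolation_def using assms by (subst measure_PiM_emb) auto
  also have "\<dots> = (\<Prod>v\<in>F. if v \<in> U then p else 1 - p)"
    using assms by (intro prod.cong) (auto simp: measure_pmf_single)
  also have "\<dots> = (\<Prod>v\<in>U. p) * (\<Prod>v\<in>F - U. 1 - p)"
    using assms by (simp add: prod.If_cases Int_absorb1 Diff_eq)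
  finally show "measure (site_percolation p) {\<omega>. open_vertices \<omega> \<inter> F = U} = p ^ card U * (1 - p) ^ card (F - U)"
    by simp
qed

text \<open>Splitting into finitely many disjoint cylinders turns an event on a finite vertex set
  into the polynomial \<open>cyl\<close>.\<close>

lemma site_percolation_finite:
  assumes "finite F" "0 \<le> p" "p \<le> 1"
  shows "{\<omega>. P (open_vertices \<omega> \<inter> F)} \<in> sets (site_percolation p)"
    and "measure (site_percolation p) {\<omega>. P (open_vertices \<omega> \<inter> F)} = cyl p F P"
proof -
  interpret prob_space "site_percolation p"
    by (rule prob_space_site_percolation)
  have eq: "{\<omega>. P (open_vertices \<omega> \<inter> F)} = (\<Union>U\<in>{U\<in>Pow F. P U}. {\<omega>. open_vertices \<omega> \<inter> F = U})"
    by auto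
  show "{\<omega>. P (open_vertices \<omega> \<inter> F)} \<in> sets (site_percolation p)"
    unfolding eq using assms site_percolation_cylinder(1)[OF assms(1) _ assms(2,3)]
    by (intro sets.finite_UN) auto
  have "measure (site_percolation p) {\<omega>. P (open_vertices \<omega> \<inter> F)} =
      (\<Sum>U\<in>{U\<in>Pow F. P U}. measure (site_percolation p) {\<omega>. open_vertices \<omega> \<inter> F = U})"
    unfolding eq using assms site_percolation_cylinder(1)[OF assms(1) _ assms(2,3)]
    by (intro finite_measure_finite_Union) (auto simp: disjoint_family_on_def)
  also have "\<dots> = (\<Sum>U\<in>{U\<in>Pow F. P U}. p ^ card U * (1 - p) ^ card (F - U))"
    using assms by (intro sum.cong) (auto simp: site_percolation_cylinder)
  also have "\<dots> = cyl p F P"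
    unfolding cyl_def using assms by (intro sum.mono_neutral_cong_left) auto
  finally show "measure (site_percolation p) {\<omega>. P (open_vertices \<omega> \<inter> F)} = cyl p F P" .
qed

section \<open>Lattice paths and connection probabilities\<close>

lemma l1_dist_self [simp]: "l1_dist x x = 0"
  by (simp add: l1_dist_def)

lemma l1_dist_commute: "l1_dist x y = l1_dist y x"
  by (simp add: l1_dist_def abs_minus_commute)

lemma l1_dist_triangle: "l1_dist x z \<le> l1_dist x y + l1_dist y z"
  unfolding l1_dist_def sum.distrib[symmetric] by (intro sum_mono) linarith

lemma l1_dist_nonneg [simp]: "0 \<le> l1_dist x y"
  unfolding l1_dist_def by (intro sum_nonneg) simp

lemma component_le_l1_dist: "\<bar>x $ i - y $ i\<bar> \<le> l1_dist x y"
  unfolding l1_dist_def by (rule member_le_sum) auto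

lemma l1_dist_translate [simp]: "l1_dist (a + x) (a + y) = l1_dist x y"
  by (simp add: l1_dist_def)

lemma lattice_box_iff: "x \<in> lattice_box n \<longleftrightarrow> (\<forall>i. \<bar>x $ i\<bar> \<le> int n)"
  by (auto simp: lattice_box_def abs_le_iff minus_le_iff)

lemma l1_dist_diff [simp]: "l1_dist (x - a) (y - a) = l1_dist x y"
  by (simp add: l1_dist_def)

lemma card_lattice_box: "card (lattice_box n :: (int ^ 'd::finite) set) = (2 * n + 1) ^ CARD('d)"
  and finite_lattice_box [simp]: "finite (lattice_box n :: (int ^ 'd::finite) set)"
proof -
  have inj: "inj_on vec_nth (lattice_box n :: (int ^ 'd) set)"
    by (auto simp: inj_on_def vec_nth_inject)
  have eq: "vec_nth ` (lattice_box n :: (int ^ 'd) set) = (UNIV \<rightarrow>\<^sub>E {- int n..int n})"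
  proof (intro equalityI subsetI)
    fix f :: "'d \<Rightarrow> int" assume "f \<in> UNIV \<rightarrow>\<^sub>E {- int n..int n}"
    then have "vec_lambda f \<in> lattice_box n"
      by (simp add: lattice_box_def PiE_iff)
    moreover have "f = vec_nth (vec_lambda f)"
      by (simp add: fun_eq_iff)
    ultimately show "f \<in> vec_nth ` (lattice_box n :: (int ^ 'd) set)"
      by (rule rev_image_eqI)
  qed (auto simp: lattice_box_def)
  have fin: "finite (vec_nth ` (lattice_box n :: (int ^ 'd) set))"
    unfolding eq by (intro finite_PiE) auto
  then show "finite (lattice_box n :: (int ^ 'd) set)"
    using inj by (simp add: finite_image_iff)
  have "card (lattice_box n :: (int ^ 'd) set) = card (vec_nth ` (lattice_box n :: (int ^ 'd) set))"
    using inj by (simp add: card_image)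
  also have "\<dots> = (2 * n + 1) ^ CARD('d)"
    unfolding eq by (simp add: card_PiE nat_add_distrib nat_mult_distrib)
  finally show "card (lattice_box n :: (int ^ 'd) set) = (2 * n + 1) ^ CARD('d)" .
qed

lemma finite_l1_ball: "finite {y :: int ^ 'd::finite. l1_dist x y \<le> k}"
proof (rule finite_subset)
  show "{y. l1_dist x y \<le> k} \<subseteq> (+) x ` lattice_box (nat k)"
  proof
    fix y assume y: "y \<in> {y. l1_dist x y \<le> k}"
    have "y - x \<in> lattice_box (nat k)"
      unfolding lattice_box_iff
    proof
      fix i
      show "\<bar>(y - x) $ i\<bar> \<le> int (nat k)"
        using y component_le_l1_dist[of x i y] l1_dist_nonneg[of x y]
        by (auto simp: abs_minus_commute simp del: l1_dist_nonneg)
    qed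
    then show "y \<in> (+) x ` lattice_box (nat k)"
      by (rule rev_image_eqI) simp
  qed
qed simp

section \<open>Joining by paths as an inductively generated relation\<close>

lemma lattice_path_snoc:
  "lattice_path (v @ [z]) \<longleftrightarrow> v = [] \<or> lattice_path v \<and> l1_dist z (last v) \<le> 1"
proof (cases "v = []")
  case False
  have "(\<forall>i. Suc i < Suc (length v) \<longrightarrow> l1_dist ((v @ [z]) ! Suc i) ((v @ [z]) ! i) \<le> 1) \<longleftrightarrow>
     (\<forall>i. Suc i < length v \<longrightarrow> l1_dist (v ! Suc i) (v ! i) \<le> 1) \<and> l1_dist z (last v) \<le> 1" (is "?L \<longleftrightarrow> ?R")
  proof
    assume L: ?L
    show ?R
    proof (intro conjI allI impI)
      fix i assume "Suc i < length v"
      then show "l1_dist (v ! Suc i) (v ! i) \<le> 1"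
        using L[rule_format, of i] by (simp add: nth_append)
    next
      show "l1_dist z (last v) \<le> 1"
        using L[rule_format, of "length v - 1"] False by (simp add: nth_append last_conv_nth)
    qed
  next
    assume R: ?R
    show ?L
    proof (intro allI impI)
      fix i assume "Suc i < Suc (length v)"
      then consider "Suc i < length v" | "Suc i = length v" by linarith
      then show "l1_dist ((v @ [z]) ! Suc i) ((v @ [z]) ! i) \<le> 1"
      proof cases
        case 1
        then show ?thesis using R by (simp add: nth_append)
      next
        case 2
        then have "last v = v ! i"
          using False by (metis diff_Suc_1 last_conv_nth)
        then show ?thesis using R 2 by (simp add: nth_append)
      qed
    qed
  qed
  then show ?thesis
    using False by (simp add: lattice_path_def)
qed (simp add: lattice_path_def)

lemma joined_in_refl: "x \<in> S \<Longrightarrow> joined_in S x x"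
  unfolding joined_in_def by (rule exI[of _ "[x]"]) (simp add: lattice_path_def)

lemma joined_in_step:
  assumes "joined_in S x y" "l1_dist z y \<le> 1" "z \<in> S"
  shows "joined_in S x z"
proof -
  obtain v where v: "lattice_path v" "hd v = x" "last v = y" "set v \<subseteq> S"
    using assms(1) by (auto simp: joined_in_def)
  then have "v \<noteq> []"
    by (simp add: lattice_path_def)
  then show ?thesis
    unfolding joined_in_def using v assms
    by (intro exI[of _ "v @ [z]"]) (simp add: lattice_path_snoc)
qed

text \<open>Induction along a path that is extended at its far end, so that later arguments about
  connections can avoid lists.\<close>

lemma joined_in_induct [consumes 1, case_names refl step]:
  assumes "joined_in S x y" "x \<in> S \<Longrightarrow> P x"
    and "\<And>y z. joined_in S x y \<Longrightarrow> P y \<Longrightarrow> l1_dist z y \<le> 1 \<Longrightarrow> z \<in> S \<Longrightarrow> P z"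
  shows "P y"
proof -
  obtain v where v: "lattice_path v" "hd v = x" "last v = y" "set v \<subseteq> S"
    using assms(1) by (auto simp: joined_in_def)
  have "joined_in S x (last v) \<and> P (last v)"
    using v(1,2,4)
  proof (induction v rule: rev_induct)
    case Nil
    then show ?case by (simp add: lattice_path_def)
  next
    case (snoc z v)
    show ?case
    proof (cases "v = []")
      case True
      then show ?thesis using snoc assms(2) by (auto intro: joined_in_refl)
    next
      case False
      then show ?thesis
        using snoc assms(3)[of "last v" z] by (auto simp: lattice_path_snoc intro: joined_in_step)
    qed
  qed
  then show ?thesis using v by simp
qed

lemma joined_in_mono: "joined_in S x y \<Longrightarrow> S \<subseteq> T \<Longrightarrow> joined_in T x y"
  unfolding joined_in_def by blast

lemma joined_in_start: "joined_in S x y \<Longrightarrow> x \<in> S"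
  by (induction rule: joined_in_induct) auto

lemma joined_in_end: "joined_in S x y \<Longrightarrow> y \<in> S"
  by (induction rule: joined_in_induct) auto

lemma joined_in_trans: "joined_in S y z \<Longrightarrow> joined_in S x y \<Longrightarrow> joined_in S x z"
  by (induction rule: joined_in_induct) (auto intro: joined_in_step)

lemma joined_in_sym: "joined_in S x y \<Longrightarrow> joined_in S y x"
proof (induction rule: joined_in_induct)
  case (step y z)
  have "joined_in S z y"
    using step joined_in_refl[of z S] joined_in_end[of S x y] joined_in_step[of S z z y]
    by (simp add: l1_dist_commute)
  with step.IH show ?case
    by (rule joined_in_trans)
qed (rule joined_in_refl)

lemma joined_in_commute: "joined_in S x y \<longleftrightarrow> joined_in S y x"
  using joined_in_sym by blast

lemma joined_in_image:
  assumes "\<And>a b. l1_dist (f a) (f b) = l1_dist a b" "joined_in S x y"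
  shows "joined_in (f ` S) (f x) (f y)"
  using assms(2)
proof (induction rule: joined_in_induct)
  case (step y z)
  then show ?case
    by (intro joined_in_step[OF step.IH]) (auto simp: assms(1))
qed (auto intro: joined_in_refl)

lemma joined_in_image_iff:
  assumes "\<And>a b. l1_dist (f a) (f b) = l1_dist a b" "bij f"
  shows "joined_in (f ` S) (f x) (f y) \<longleftrightarrow> joined_in S x y"
proof
  have inv: "l1_dist (inv f a) (inv f b) = l1_dist a b" for a b
    using assms by (metis bij_inv_eq_iff)
  assume "joined_in (f ` S) (f x) (f y)"
  from joined_in_image[OF inv this] show "joined_in S x y"
    using assms(2) by (simp add: image_comp bij_is_inj)
qed (rule joined_in_image[OF assms(1)])

text \<open>\<open>cyl p A\<close> ranges over subsets of \<open>A\<close> only, so the connecting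
  path is confined to \<open>A\<close>.\<close>

definition conn :: "real \<Rightarrow> (int ^ 'd) set \<Rightarrow> int ^ 'd \<Rightarrow> int ^ 'd \<Rightarrow> real" where
  "conn p A x y = cyl p A (\<lambda>U. joined_in U x y)"

lemma measure_connection_event:
  assumes "finite A" "0 \<le> p" "p \<le> 1"
  shows "measure (site_percolation p) (connection_event x y A) = conn p A x y"
  unfolding connection_event_def conn_def using assms by (intro site_percolation_finite)

lemma conn_commute: "conn p A x y = conn p A y x"
  by (simp add: conn_def joined_in_commute)

lemma conn_mono:
  assumes "0 \<le> p" "p \<le> 1" "finite B" "A \<subseteq> B"
  shows "conn p A x y \<le> conn p B x y"
  unfolding conn_def using assms by (intro cyl_subset_mono) (auto intro: joined_in_mono)

lemma conn_image:
  assumes "\<And>a b. l1_dist (f a) (f b) = l1_dist a b" "bij f"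
  shows "conn p (f ` A) (f x) (f y) = conn p A x y"
  unfolding conn_def using assms
  by (subst cyl_image) (simp_all add: joined_in_image_iff inj_on_subset[OF bij_is_inj])

lemma conn_translate: "conn p ((+) a ` A) (a + x) (a + y) = conn p A x y"
  by (rule conn_image) (auto simp: bij_plus_right)

text \<open>Both connections are increasing in the open set, so Harris' inequality applies; the two
  paths are then concatenated.\<close>

lemma conn_trans:
  assumes "0 \<le> p" "p \<le> 1" "finite A"
  shows "conn p A x y * conn p A y z \<le> conn p A x z"
proof -
  have "conn p A x y * conn p A y z \<le> cyl p A (\<lambda>U. joined_in U x y \<and> joined_in U y z)"
    unfolding conn_def using assms by (intro harris_inequality) (auto intro: joined_in_mono)
  also have "\<dots> \<le> conn p A x z"
    unfolding conn_def using assms by (intro cyl_mono) (auto intro: joined_in_trans)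
  finally show ?thesis .
qed

lemma conn_ge_power_card:
  assumes "0 \<le> p" "p \<le> 1" "finite A" "joined_in A x y"
  shows "p ^ card A \<le> conn p A x y"
  unfolding cyl_all_open[OF assms(3), symmetric] conn_def
  using assms by (intro cyl_mono) (auto intro: joined_in_mono)

lemma lattice_box_joined_in:
  assumes "x \<in> lattice_box n" "y \<in> lattice_box n"
  shows "joined_in (lattice_box n) x (y :: int ^ 'd::finite)"
  using assms(2)
proof (induction "nat (l1_dist x y)" arbitrary: y rule: less_induct)
  case less
  show ?case
  proof (cases "x = y")
    case True
    then show ?thesis using assms by (simp add: joined_in_refl)
  next
    case False
    then obtain i where i: "x $ i \<noteq> y $ i"
      by (auto simp: vec_eq_iff)
    \<comment> \<open>\<open>z\<close> is \<open>y\<close> moved one unit towards \<open>x\<close>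
      in coordinate \<open>i\<close>, hence closer to \<open>x\<close> and still in the box.\<close>
    define z where "z = (\<chi> j. if j = i then y $ i + sgn (x $ i - y $ i) else y $ j)"
    have zi: "\<bar>x $ i - z $ i\<bar> = \<bar>x $ i - y $ i\<bar> - 1"
      using i by (auto simp: z_def sgn_if)
    have zj: "z $ j = y $ j" if "j \<noteq> i" for j
      using that by (simp add: z_def)
    have "l1_dist x z < l1_dist x y"
      unfolding l1_dist_def
    proof (rule sum_strict_mono_ex1)
      show "\<forall>j\<in>UNIV. \<bar>x $ j - z $ j\<bar> \<le> \<bar>x $ j - y $ j\<bar>"
      proof
        fix j show "\<bar>x $ j - z $ j\<bar> \<le> \<bar>x $ j - y $ j\<bar>"
          using zi zj[of j] by (cases "j = i") auto
      qed
      show "\<exists>j\<in>UNIV. \<bar>x $ j - z $ j\<bar> < \<bar>x $ j - y $ j\<bar>"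
        using zi by (intro bexI[of _ i]) auto
    qed simp
    moreover have "z \<in> lattice_box n"
      unfolding lattice_box_iff
    proof
      fix j
      have "\<bar>x $ j\<bar> \<le> int n" "\<bar>y $ j\<bar> \<le> int n"
        using assms(1) less.prems by (auto simp: lattice_box_iff)
      then show "\<bar>z $ j\<bar> \<le> int n"
        using i by (cases "j = i") (auto simp: z_def sgn_if)
    qed
    ultimately have "joined_in (lattice_box n) x z"
      using less.hyps[of z] l1_dist_nonneg[of x z] by linarith
    moreover have "l1_dist y z \<le> 1"
    proof -
      have "l1_dist y z = (\<Sum>j\<in>UNIV. if j = i then 1 else 0)"
        unfolding l1_dist_def using i by (intro sum.cong) (auto simp: z_def sgn_if)
      then show ?thesis by simp
    qed
    ultimately show ?thesis
      using less.prems by (rule joined_in_step)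
  qed
qed

section \<open>Exploration of a cluster\<close>

definition outer_boundary :: "(int ^ 'd) set \<Rightarrow> (int ^ 'd) set" where
  "outer_boundary W = {y. y \<notin> W \<and> (\<exists>v\<in>W. l1_dist v y \<le> 1)}"

lemma finite_outer_boundary [simp]:
  assumes "finite W"
  shows "finite (outer_boundary W :: (int ^ 'd::finite) set)"
proof (rule finite_subset)
  show "outer_boundary W \<subseteq> (\<Union>v\<in>W. {y. l1_dist v y \<le> 1})"
    by (auto simp: outer_boundary_def)
qed (use assms finite_l1_ball in auto)

definition cluster :: "(int ^ 'd) set \<Rightarrow> (int ^ 'd) set" where
  "cluster U = {v. joined_in U 0 v}"

lemma cluster_subset: "cluster U \<subseteq> U"
  by (auto simp: cluster_def joined_in_end)

lemma zero_in_cluster: "v \<in> cluster U \<Longrightarrow> 0 \<in> cluster U"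
  by (auto simp: cluster_def joined_in_refl joined_in_start)

text \<open>Whether the cluster is \<open>C\<close> is decided by the states in \<open>C\<close> and
  on its boundary, where closed vertices stop the growth. This locality later yields independence
  from the rest of the configuration.\<close>

lemma cluster_eq_transfer:
  assumes "cluster A = C" "0 \<in> C" "A \<inter> (C \<union> outer_boundary C) = B \<inter> (C \<union> outer_boundary C)"
  shows "cluster B = C"
proof (intro equalityI subsetI)
  fix v assume "v \<in> cluster B"
  then have "joined_in B 0 v" by (simp add: cluster_def)
  then show "v \<in> C"
  proof (induction rule: joined_in_induct)
    case (step y z)
    show "z \<in> C"
    proof (rule ccontr)
      assume z: "z \<notin> C"
      then have "z \<in> outer_boundary C"
        using step by (auto simp: outer_boundary_def l1_dist_commute)
      then have "z \<in> A"
        using step assms(3) by blast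
      moreover have "joined_in A 0 y"
        using step.IH assms(1) by (auto simp: cluster_def)
      ultimately have "joined_in A 0 z"
        using step by (blast intro: joined_in_step)
      then show False
        using z assms(1) by (auto simp: cluster_def)
    qed
  qed (rule assms(2))
next
  fix v assume "v \<in> C"
  then have "joined_in A 0 v" using assms(1) by (auto simp: cluster_def)
  then have "joined_in B 0 v"
  proof (induction rule: joined_in_induct)
    case refl
    then show ?case using assms by (blast intro: joined_in_refl)
  next
    case (step y z)
    have "z \<in> C"
      using step assms(1) by (auto simp: cluster_def intro: joined_in_step)
    then have "z \<in> B"
      using step assms(3) by blast
    then show ?case
      using step by (blast intro: joined_in_step)
  qed
  then show "v \<in> cluster B" by (simp add: cluster_def)
qed

definition adjacent_to :: "int ^ 'd \<Rightarrow> (int ^ 'd) set \<Rightarrow> bool" where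
  "adjacent_to y C \<longleftrightarrow> (\<exists>v\<in>C. l1_dist v y \<le> 1)"

definition reaches :: "int ^ 'd \<Rightarrow> int \<Rightarrow> (int ^ 'd) set \<Rightarrow> bool" where
  "reaches x k U \<longleftrightarrow> (\<exists>z. k \<le> l1_dist x z \<and> joined_in U x z)"

lemma reaches_mono: "reaches x k U \<Longrightarrow> U \<subseteq> V \<Longrightarrow> reaches x k V"
  unfolding reaches_def using joined_in_mono by blast

text \<open>The first step of the path that leaves the cluster of the origin inside \<open>W\<close> for good also leaves
  \<open>W\<close>, and from then on the path avoids every vertex whose state determines that cluster.\<close>

lemma leave_cluster:
  assumes "joined_in U 0 z" "0 \<in> W"
  defines "C \<equiv> cluster (U \<inter> W)"
  shows "z \<in> C \<or> (\<exists>y\<in>outer_boundary W. adjacent_to y C \<and>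
    joined_in (U - W \<inter> (C \<union> outer_boundary C)) y z)"
  using assms(1)
proof (induction rule: joined_in_induct)
  case refl
  then show ?case using assms by (simp add: cluster_def joined_in_refl)
next
  case (step y z)
  have CW: "C \<subseteq> W"
    using cluster_subset[of "U \<inter> W"] by (auto simp: C_def)
  have grow: "b \<in> C" if "a \<in> C" "l1_dist b a \<le> 1" "b \<in> U" "b \<in> W" for a b
    using that joined_in_step[of "U \<inter> W" 0 a b] by (simp add: C_def cluster_def)
  from step.IH show ?case
  proof
    assume y: "y \<in> C"
    show ?thesis
    proof (cases "z \<in> W")
      case True
      then show ?thesis using grow[OF y] step by blast
    next
      case False
      have "z \<in> outer_boundary W" "adjacent_to z C"
        using False y CW step by (auto simp: outer_boundary_def adjacent_to_def l1_dist_commute)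
      moreover have "joined_in (U - W \<inter> (C \<union> outer_boundary C)) z z"
        using False step by (intro joined_in_refl) auto
      ultimately show ?thesis by blast
    qed
  next
    assume "\<exists>x\<in>outer_boundary W. adjacent_to x C \<and> joined_in (U - W \<inter> (C \<union> outer_boundary C)) x y"
    then obtain x where x: "x \<in> outer_boundary W" "adjacent_to x C"
      "joined_in (U - W \<inter> (C \<union> outer_boundary C)) x y"
      by blast
    show ?thesis
    proof (cases "z \<in> C")
      case False
      \<comment> \<open>An open vertex of \<open>W\<close> next to \<open>C\<close> would itself
        belong to \<open>C\<close>.\<close>
      have "z \<notin> W \<inter> outer_boundary C"
        using grow False step.hyps by (auto simp: outer_boundary_def l1_dist_commute)
      then have "joined_in (U - W \<inter> (C \<union> outer_boundary C)) x z"
        using joined_in_step[OF x(3)] step.hyps False by blast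
      then show ?thesis using x by blast
    qed simp
  qed
qed

text \<open>A site version of the quantity phi_p(S) of Duminil-Copin and Tassion, counting boundary
  vertices instead of edges and leaving out the state of the boundary vertex itself.\<close>

definition exit_mean :: "real \<Rightarrow> (int ^ 'd) set \<Rightarrow> real" where
  "exit_mean p W = (\<Sum>y\<in>outer_boundary W. cyl p W (\<lambda>U. adjacent_to y (cluster U)))"

lemma cyl_exists_le:
  assumes "finite I" "0 \<le> p" "p \<le> 1"
  shows "cyl p F (\<lambda>U. \<exists>i\<in>I. P i U) \<le> (\<Sum>i\<in>I. cyl p F (P i))"
proof -
  have "cyl p F (\<lambda>U. \<exists>i\<in>I. P i U) \<le>
    (\<Sum>U\<in>Pow F. \<Sum>i\<in>I. of_bool (P i U) * (p ^ card U * (1 - p) ^ card (F - U)))"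
    unfolding cyl_def
  proof (rule sum_mono)
    fix U
    have "of_bool (\<exists>i\<in>I. P i U) \<le> (\<Sum>i\<in>I. of_bool (P i U) :: real)"
    proof (cases "\<exists>i\<in>I. P i U")
      case True
      then obtain i where i: "i \<in> I" "P i U" by blast
      have "(of_bool (P i U) :: real) \<le> (\<Sum>i\<in>I. of_bool (P i U))"
        using i assms by (intro member_le_sum) auto
      then show ?thesis using True i by simp
    qed (simp add: sum_nonneg)
    then show "of_bool (\<exists>i\<in>I. P i U) * (p ^ card U * (1 - p) ^ card (F - U))
      \<le> (\<Sum>i\<in>I. of_bool (P i U) * (p ^ card U * (1 - p) ^ card (F - U)))"
      unfolding sum_distrib_right[symmetric] using assms by (intro mult_right_mono) auto
  qed
  also have "\<dots> = (\<Sum>i\<in>I. cyl p F (P i))"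
    unfolding cyl_def by (rule sum.swap)
  finally show ?thesis .
qed

text \<open>Splits an event according to the value of \<open>f\<close>, later the cluster, when that
  value determines the event.\<close>

lemma cyl_eq_sum_image:
  assumes "finite F" "finite I" "\<And>U. U \<subseteq> F \<Longrightarrow> P U \<Longrightarrow> f U \<in> I" "\<And>U. U \<subseteq> F \<Longrightarrow> f U \<in> I \<Longrightarrow> P U"
  shows "cyl p F P = (\<Sum>C\<in>I. cyl p F (\<lambda>U. f U = C))"
proof -
  have "(\<Sum>C\<in>I. cyl p F (\<lambda>U. f U = C)) =
     (\<Sum>U\<in>Pow F. \<Sum>C\<in>I. of_bool (f U = C) * (p ^ card U * (1 - p) ^ card (F - U)))"
    unfolding cyl_def by (rule sum.swap)
  also have "\<dots> = cyl p F P"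
    unfolding cyl_def
  proof (rule sum.cong[OF refl])
    fix U assume "U \<in> Pow F"
    then have "P U \<longleftrightarrow> f U \<in> I"
      using assms by auto
    then show "(\<Sum>C\<in>I. of_bool (f U = C) * (p ^ card U * (1 - p) ^ card (F - U))) =
       of_bool (P U) * (p ^ card U * (1 - p) ^ card (F - U))"
      unfolding sum_distrib_right[symmetric] using assms(2) by (simp add: of_bool_def)
  qed
  finally show ?thesis ..
qed

lemma cyl_reaches_translate:
  "cyl p A (reaches x k) = cyl p ((+) (- x) ` A) (reaches (0 :: int ^ 'd::finite) k)"
proof (subst cyl_image)
  show "cyl p A (reaches x k) = cyl p A (\<lambda>U. reaches 0 k ((+) (- x) ` U))"
  proof (rule cyl_cong)
    fix U
    have 1: "joined_in ((+) (- x) ` U) 0 (- x + z) \<longleftrightarrow> joined_in U x z" for z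
      using joined_in_image_iff[of "(+) (- x)" U x z] by (simp add: bij_plus_right)
    have 2: "l1_dist 0 (- x + z) = l1_dist x z" for z
      using l1_dist_translate[of "- x" x z] by simp
    show "reaches x k U = reaches 0 k ((+) (- x) ` U)"
    proof
      assume "reaches x k U"
      then show "reaches 0 k ((+) (- x) ` U)"
        unfolding reaches_def using 1 2 by metis
    next
      assume "reaches 0 k ((+) (- x) ` U)"
      then obtain z where "k \<le> l1_dist 0 z" "joined_in ((+) (- x) ` U) 0 z"
        unfolding reaches_def by blast
      then show "reaches x k U"
        unfolding reaches_def using 1[of "x + z"] 2[of "x + z"] by (intro exI[of _ "x + z"]) simp
    qed
  qed
qed simp

text \<open>A recursion of Simon-Lieb type: a path to distance \<open>Suc j * L\<close> leaves
  \<open>W\<close> at a boundary vertex \<open>y\<close> next to the cluster \<open>C\<close>, then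
  covers distance \<open>j * L\<close> through unexamined vertices. \<open>A\<close> stays arbitrary
  because the examined vertices are removed.\<close>

lemma reaches_decay:
  fixes W A :: "(int ^ 'd::finite) set"
  assumes p: "0 \<le> p" "p \<le> 1" and W: "finite W" "0 \<in> W"
    and L: "\<And>y. y \<in> W \<union> outer_boundary W \<Longrightarrow> l1_dist 0 y < L"
    and "finite A"
  shows "cyl p A (reaches 0 (int j * L)) \<le> exit_mean p W ^ j"
  using \<open>finite A\<close>
proof (induction j arbitrary: A)
  case 0
  then show ?case using p by (simp add: cyl_le_1)
next
  case (Suc j)
  \<comment> \<open>Adding \<open>W\<close> can only raise the probability of an increasing event,
    and it gives the cluster inside \<open>W\<close> its full law.\<close>
  define B where "B = A \<union> W"
  have B: "finite B" "W \<subseteq> B"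
    using Suc W by (auto simp: B_def)
  have IH: "cyl p F (reaches y (int j * L)) \<le> exit_mean p W ^ j" if "finite F" for F and y :: "int ^ 'd"
    unfolding cyl_reaches_translate[of p F] using that by (intro Suc.IH) simp
  have \<phi>: "0 \<le> exit_mean p W ^ j"
    unfolding exit_mean_def using p by (intro zero_le_power sum_nonneg cyl_nonneg)
  \<comment> \<open>The vertices whose states decide whether the cluster inside \<open>W\<close> is
    \<open>C\<close>.\<close>
  define G where "G C = W \<inter> (C \<union> outer_boundary C)" for C :: "(int ^ 'd) set"
  define I where "I y = {C\<in>Pow W. 0 \<in> C \<and> adjacent_to y C}" for y
  have finI: "finite (I y)" for y
    using W by (simp add: I_def)
  have "cyl p A (reaches 0 (int (Suc j) * L)) \<le> cyl p B (reaches 0 (int (Suc j) * L))"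
    using p B by (intro cyl_subset_mono) (auto simp: B_def intro: reaches_mono)
  also have "\<dots> \<le> cyl p B (\<lambda>U. \<exists>y\<in>outer_boundary W. \<exists>C\<in>I y.
      cluster (U \<inter> W) = C \<and> reaches y (int j * L) (U - G C))"
  proof (rule cyl_mono[OF p])
    fix U assume "U \<subseteq> B" "reaches 0 (int (Suc j) * L) U"
    then obtain z where z: "int (Suc j) * L \<le> l1_dist 0 z" "joined_in U 0 z"
      by (auto simp: reaches_def)
    define C where "C = cluster (U \<inter> W)"
    have CW: "C \<subseteq> W"
      using cluster_subset[of "U \<inter> W"] by (auto simp: C_def)
    have "0 \<le> int j * L"
      using L[of 0] W by simp
    then have "L \<le> l1_dist 0 z"
      using z(1) by (simp add: algebra_simps)
    then have "z \<notin> C"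
      using L[of z] CW by auto
    then obtain y where y: "y \<in> outer_boundary W" "adjacent_to y C" "joined_in (U - G C) y z"
      using leave_cluster[OF z(2) W(2)] by (auto simp: C_def G_def)
    have "int j * L \<le> l1_dist y z"
      using z(1) L[of y] y(1) l1_dist_triangle[of 0 z y] by (simp add: algebra_simps)
    then have "reaches y (int j * L) (U - G C)"
      using y(3) by (auto simp: reaches_def)
    moreover have "C \<in> I y"
      using y(2) CW zero_in_cluster by (auto simp: I_def adjacent_to_def C_def)
    ultimately show "\<exists>y\<in>outer_boundary W. \<exists>C\<in>I y.
      cluster (U \<inter> W) = C \<and> reaches y (int j * L) (U - G C)"
      using y(1) C_def by blast
  qed
  also have "\<dots> \<le> (\<Sum>y\<in>outer_boundary W. \<Sum>C\<in>I y.
      cyl p B (\<lambda>U. cluster (U \<inter> W) = C \<and> reaches y (int j * L) (U - G C)))"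
    using finI p W by (intro order_trans[OF cyl_exists_le] sum_mono cyl_exists_le) auto
  also have "\<dots> \<le> (\<Sum>y\<in>outer_boundary W. \<Sum>C\<in>I y. cyl p W (\<lambda>U. cluster U = C) * exit_mean p W ^ j)"
  proof (intro sum_mono)
    fix y C assume "C \<in> I y"
    then have C: "0 \<in> C" "C \<subseteq> W"
      by (auto simp: I_def)
    have local: "cluster (U \<inter> W) = C \<longleftrightarrow> cluster (U \<inter> G C) = C" for U
    proof -
      have "U \<inter> W \<inter> (C \<union> outer_boundary C) = U \<inter> G C \<inter> (C \<union> outer_boundary C)"
        by (auto simp: G_def)
      then show ?thesis
        using cluster_eq_transfer[of "U \<inter> W" C "U \<inter> G C"] cluster_eq_transfer[of "U \<inter> G C" C "U \<inter> W"] C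
        by auto
    qed
    have GB: "finite (G C)" "finite (B - G C)" "G C \<union> (B - G C) = B" "G C \<subseteq> W"
      using B W by (auto simp: G_def)
    have "cyl p B (\<lambda>U. cluster (U \<inter> W) = C \<and> reaches y (int j * L) (U - G C)) =
       cyl p (G C \<union> (B - G C)) (\<lambda>U. cluster (U \<inter> G C) = C \<and> reaches y (int j * L) (U \<inter> (B - G C)))"
      unfolding GB(3)
    proof (rule cyl_cong)
      fix U assume "U \<subseteq> B"
      then have "U \<inter> (B - G C) = U - G C" by auto
      then show "(cluster (U \<inter> W) = C \<and> reaches y (int j * L) (U - G C)) =
        (cluster (U \<inter> G C) = C \<and> reaches y (int j * L) (U \<inter> (B - G C)))"
        by (simp add: local)
    qed
    \<comment> \<open>Independence: the cluster is decided on \<open>G C\<close>, the remaining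
      journey off it.\<close>
    also have "\<dots> = cyl p (G C) (\<lambda>U. cluster U = C) * cyl p (B - G C) (reaches y (int j * L))"
      using GB by (intro cyl_Un) auto
    also have "cyl p (G C) (\<lambda>U. cluster U = C) = cyl p W (\<lambda>U. cluster (U \<inter> G C) = C)"
      using GB W by (intro cyl_restrict[symmetric]) auto
    also have "\<dots> = cyl p W (\<lambda>U. cluster U = C)"
    proof (rule cyl_cong)
      fix U assume "U \<subseteq> W"
      then show "(cluster (U \<inter> G C) = C) = (cluster U = C)"
        using local[of U] by (simp add: Int_absorb2)
    qed
    finally show "cyl p B (\<lambda>U. cluster (U \<inter> W) = C \<and> reaches y (int j * L) (U - G C))
      \<le> cyl p W (\<lambda>U. cluster U = C) * exit_mean p W ^ j"
      using IH[OF GB(2), of y] p by (simp add: mult_left_mono cyl_nonneg)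
  qed
  \<comment> \<open>Summing over the possible clusters \<open>C\<close> restores the adjacency
    probabilities that make up \<open>exit_mean p W\<close>.\<close>
  also have "\<dots> = exit_mean p W * exit_mean p W ^ j"
    unfolding exit_mean_def[of p W] sum_distrib_right[symmetric]
  proof (intro arg_cong2[of _ _ _ _ "(*)"] sum.cong refl)
    fix y
    show "(\<Sum>C\<in>I y. cyl p W (\<lambda>U. cluster U = C)) = cyl p W (\<lambda>U. adjacent_to y (cluster U))"
    proof (rule cyl_eq_sum_image[OF W(1) finI, symmetric])
      fix U assume "U \<subseteq> W"
      then show "cluster U \<in> I y" if "adjacent_to y (cluster U)"
        using that cluster_subset[of U] zero_in_cluster[of _ U] by (auto simp: I_def adjacent_to_def)
    qed (auto simp: I_def)
  qed
  finally show ?case by simp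
qed

section \<open>The critical point\<close>

lemma lattice_box_mono: "m \<le> n \<Longrightarrow> lattice_box m \<subseteq> lattice_box n"
  by (fastforce simp: lattice_box_iff intro: order_trans)

lemma in_some_lattice_box: "\<exists>n. (x :: int ^ 'd::finite) \<in> lattice_box n"
proof
  show "x \<in> lattice_box (nat (l1_dist x 0))"
    using component_le_l1_dist[of x _ 0] by (simp add: lattice_box_iff)
qed

lemma joined_in_bounded:
  assumes "joined_in S x (y :: int ^ 'd::finite)"
  shows "\<exists>n. joined_in (S \<inter> lattice_box n) x y"
  using assms
proof (induction rule: joined_in_induct)
  case refl
  then show ?case
    using in_some_lattice_box[of x] by (blast intro: joined_in_refl)
next
  case (step y z)
  then obtain m n where "joined_in (S \<inter> lattice_box m) x y" "z \<in> lattice_box n"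
    using in_some_lattice_box by blast
  then have "joined_in (S \<inter> lattice_box (max m n)) x y" "z \<in> lattice_box (max m n)"
    using lattice_box_mono[of m "max m n"] lattice_box_mono[of n "max m n"]
    by (auto elim!: joined_in_mono)
  then show ?case
    using step by (blast intro: joined_in_step)
qed

text \<open>Paths are finite, so reaching distance \<open>k\<close> is an increasing union of events
  on finite boxes.\<close>

lemma reaches_bounded:
  "reaches x k S \<longleftrightarrow> (\<exists>n. reaches (x :: int ^ 'd::finite) k (S \<inter> lattice_box n))"
  using joined_in_bounded unfolding reaches_def by (meson inf_le1 joined_in_mono)

lemma infinite_cluster_reaches:
  assumes "infinite S" "lattice_connected S" "S \<subseteq> T"
  shows "\<exists>x. \<forall>k. reaches (x :: int ^ 'd::finite) k T"
proof -
  obtain x where x: "x \<in> S"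
    using assms(1) by fastforce
  have "reaches x k T" for k
  proof -
    have "\<not> S \<subseteq> {y. l1_dist x y \<le> k}"
      using assms(1) finite_l1_ball finite_subset by blast
    then obtain y where "y \<in> S" "k \<le> l1_dist x y"
      by force
    then show ?thesis
      using x assms unfolding reaches_def lattice_connected_def by (blast intro: joined_in_mono)
  qed
  then show ?thesis by blast
qed

text \<open>An infinite cluster contains a vertex joined to arbitrarily distant ones. By exponential
  decay this has probability 0 for each of the countably many vertices.\<close>

lemma no_infinite_cluster:
  fixes W :: "(int ^ 'd::finite) set"
  assumes p: "0 \<le> p" "p \<le> 1" and W: "finite W" "0 \<in> W" and exit: "exit_mean p W < 1"
  shows "measure (site_percolation p) (infinite_cluster_event :: (int ^ 'd \<Rightarrow> bool) set) = 0"
proof -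
  let ?M = "site_percolation p :: (int ^ 'd \<Rightarrow> bool) measure"
  interpret prob_space ?M
    by (rule prob_space_site_percolation)
  \<comment> \<open>Any number exceeding all of these finitely many distances would do.\<close>
  define L where "L = (\<Sum>y\<in>W \<union> outer_boundary W. l1_dist 0 y) + 1"
  have L: "l1_dist 0 y < L" if "y \<in> W \<union> outer_boundary W" for y
  proof -
    have "l1_dist 0 y \<le> (\<Sum>y\<in>W \<union> outer_boundary W. l1_dist 0 y)"
      using that W by (intro member_le_sum) auto
    then show ?thesis by (simp add: L_def)
  qed
  define E where "E x j n = {\<omega>. reaches x (int j * L) (open_vertices \<omega> \<inter> lattice_box n)}"
    for x :: "int ^ 'd" and j n
  define H where "H x j = (\<Union>n. E x j n)" for x j
  have E_sets: "E x j n \<in> sets ?M" for x j n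
    unfolding E_def using p by (intro site_percolation_finite) auto
  have E_le: "measure ?M (E x j n) \<le> exit_mean p W ^ j" for x j n
  proof -
    have "measure ?M (E x j n) = cyl p (lattice_box n) (reaches x (int j * L))"
      unfolding E_def using p by (intro site_percolation_finite) auto
    also have "\<dots> \<le> exit_mean p W ^ j"
      unfolding cyl_reaches_translate[of p "lattice_box n"]
      using p W L by (intro reaches_decay) auto
    finally show ?thesis .
  qed
  have H_le: "measure ?M (H x j) \<le> exit_mean p W ^ j" for x j
  proof (rule LIMSEQ_le_const2)
    have "incseq (E x j)"
    proof (rule incseq_SucI)
      fix n show "E x j n \<subseteq> E x j (Suc n)"
        unfolding E_def using lattice_box_mono[of n "Suc n"] by (auto elim!: reaches_mono)
    qed
    then show "(\<lambda>n. measure ?M (E x j n)) \<longlonglongrightarrow> measure ?M (H x j)"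
      unfolding H_def using E_sets by (intro finite_Lim_measure_incseq) auto
  qed (use E_le in auto)
  have H_sets: "H x j \<in> sets ?M" for x j
    unfolding H_def using E_sets by auto
  have null: "(\<Inter>j. H x j) \<in> null_sets ?M" for x
  proof -
    have le: "measure ?M (\<Inter>j. H x j) \<le> exit_mean p W ^ j" for j
      using H_sets by (intro order_trans[OF finite_measure_mono H_le]) auto
    have "0 \<le> exit_mean p W"
      unfolding exit_mean_def using p by (intro sum_nonneg cyl_nonneg)
    then have "(\<lambda>j. exit_mean p W ^ j) \<longlonglongrightarrow> 0"
      using exit by (intro LIMSEQ_realpow_zero) auto
    then have "measure ?M (\<Inter>j. H x j) \<le> 0"
      using le by (intro LIMSEQ_le_const) auto
    then have "measure ?M (\<Inter>j. H x j) = 0"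
      by (simp add: measure_le_0_iff)
    then show ?thesis
      using H_sets by (auto simp: null_sets_def emeasure_eq_measure)
  qed
  have "(\<Union>x\<in>lattice_box n. \<Inter>j. H x j) \<in> null_sets ?M" for n
    by (intro null_sets_UN' countable_finite null) simp
  then have "(\<Union>n. \<Union>x\<in>lattice_box n. \<Inter>j. H x j) \<in> null_sets ?M"
    by (rule null_sets_UN)
  moreover have "infinite_cluster_event \<subseteq> (\<Union>n. \<Union>x\<in>lattice_box n. \<Inter>j. H x j)"
  proof
    fix \<omega> :: "int ^ 'd \<Rightarrow> bool" assume "\<omega> \<in> infinite_cluster_event"
    then obtain S where "infinite S" "lattice_connected S" "S \<subseteq> open_vertices \<omega>"
      by (auto simp: infinite_cluster_event_def)
    from infinite_cluster_reaches[OF this]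
    obtain x :: "int ^ 'd" where "\<forall>k. reaches x k (open_vertices \<omega>)"
      by blast
    then have "\<omega> \<in> (\<Inter>j. H x j)"
      unfolding H_def E_def using reaches_bounded[of x] by blast
    then show "\<omega> \<in> (\<Union>n. \<Union>x\<in>lattice_box n. \<Inter>j. H x j)"
      using in_some_lattice_box[of x] by blast
  qed
  ultimately have "infinite_cluster_event \<in> null_sets ?M" if "infinite_cluster_event \<in> sets ?M"
    using that null_sets_subset by blast
  \<comment> \<open>Outside the sigma-algebra \<open>measure\<close> has the default value 0, so
    both cases give the claim.\<close>
  then show ?thesis
    by (cases "(infinite_cluster_event :: (int ^ 'd \<Rightarrow> bool) set) \<in> sets ?M")
      (auto simp: measure_notin_sets measure_eq_0_null_sets)
qed

section \<open>Bounds at the critical probability\<close>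

lemma critical_probability_ge:
  assumes "0 \<le> p" "p \<le> 1"
    "measure (site_percolation p) (infinite_cluster_event :: (int ^ 'd::finite \<Rightarrow> bool) set) = 0"
  shows "p \<le> critical_probability TYPE('d)"
  unfolding critical_probability_def using assms
  by (intro cSup_upper) (auto intro: bdd_aboveI[of _ 1])

lemma exit_mean_singleton_le:
  assumes "0 \<le> p" "p \<le> 1"
  shows "exit_mean p {0 :: int ^ 'd::finite} \<le> real (card (outer_boundary {0 :: int ^ 'd})) * p"
proof -
  have "cyl p {0 :: int ^ 'd} (\<lambda>U. adjacent_to y (cluster U)) \<le> p" for y
  proof -
    have "cyl p {0 :: int ^ 'd} (\<lambda>U. adjacent_to y (cluster U)) \<le> cyl p {0 :: int ^ 'd} (\<lambda>U. {0} \<subseteq> U)"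
    proof (rule cyl_mono[OF assms])
      fix U assume "adjacent_to y (cluster U)"
      then show "{0} \<subseteq> U"
        using zero_in_cluster[of _ U] cluster_subset[of U] by (auto simp: adjacent_to_def)
    qed
    then show ?thesis
      by (subst (asm) cyl_all_open) auto
  qed
  then have "exit_mean p {0 :: int ^ 'd} \<le> (\<Sum>y\<in>outer_boundary {0 :: int ^ 'd}. p)"
    unfolding exit_mean_def by (rule sum_mono)
  then show ?thesis by simp
qed

lemma critical_probability_pos: "0 < critical_probability TYPE('d::finite)"
proof -
  define K where "K = real (card (outer_boundary {0 :: int ^ 'd}))"
  \<comment> \<open>For \<open>W = {0}\<close> the mean is at most \<open>K * p\<close>, which this
    choice makes less than 1.\<close>
  define p where "p = 1 / (K + 1)"
  have K: "0 \<le> K" by (simp add: K_def)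
  then have p: "0 < p" "p \<le> 1" "K * p < 1"
    by (auto simp: p_def field_simps)
  then have "exit_mean p {0 :: int ^ 'd} < 1"
    using exit_mean_singleton_le[of p, where 'd = 'd] by (simp add: K_def)
  then have "p \<le> critical_probability TYPE('d)"
    using p by (intro critical_probability_ge no_infinite_cluster[of p "{0}"]) auto
  then show ?thesis using p by simp
qed

lemma critical_probability_le_1: "critical_probability TYPE('d::finite) \<le> 1"
proof -
  \<comment> \<open>The value \<open>p = 0\<close> shows that the set under the supremum is
    nonempty.\<close>
  have "measure (site_percolation 0) (infinite_cluster_event :: (int ^ 'd \<Rightarrow> bool) set) = 0"
    using exit_mean_singleton_le[of 0, where 'd = 'd] by (intro no_infinite_cluster[of _ "{0}"]) auto
  then show ?thesis
    unfolding critical_probability_def by (intro cSup_least) (auto intro!: exI[of _ 0])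
qed

text \<open>\<open>exit_mean\<close> is a polynomial in \<open>p\<close>. If it were below 1 at the
  critical point, it would stay so slightly to the right, and infinite clusters would be absent
  above the supremum.\<close>

lemma exit_mean_critical:
  fixes W :: "(int ^ 'd::finite) set"
  assumes "critical_probability TYPE('d) < 1" "finite W" "0 \<in> W"
  shows "1 \<le> exit_mean (critical_probability TYPE('d)) W"
proof (rule ccontr)
  let ?pc = "critical_probability TYPE('d)"
  assume "\<not> 1 \<le> exit_mean ?pc W"
  moreover have "continuous_on UNIV (\<lambda>p. exit_mean p W)"
    unfolding exit_mean_def by (intro continuous_intros continuous_on_cyl)
  then have "((\<lambda>p. exit_mean p W) \<longlongrightarrow> exit_mean ?pc W) (at_right ?pc)"
    by (auto simp: continuous_on_eq_continuous_within continuous_at filterlim_at_split)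
  ultimately have "eventually (\<lambda>p. exit_mean p W < 1) (at_right ?pc)"
    by (intro order_tendstoD(2)) auto
  moreover have "eventually (\<lambda>p. p < 1) (at_right ?pc)"
    using assms(1) by (intro order_tendstoD(2)[OF tendsto_ident_at])
  moreover have "eventually (\<lambda>p. ?pc < p) (at_right ?pc)"
    by (rule eventually_at_right_less)
  ultimately have "eventually (\<lambda>p. exit_mean p W < 1 \<and> p < 1 \<and> ?pc < p) (at_right ?pc)"
    by (intro eventually_conj)
  then obtain p where p: "exit_mean p W < 1" "p < 1" "?pc < p"
    using eventually_happens'[OF trivial_limit_at_right_real] by blast
  then have "p \<le> ?pc"
    using critical_probability_pos[where 'd = 'd] assms
    by (intro critical_probability_ge no_infinite_cluster[of p W]) auto
  then show False using p by simp
qed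

section \<open>Curves of well-connected points\<close>

text \<open>The box has \<open>(2 * m + 1) ^ CARD('d)\<close> points, at most
  \<open>(3 * m) ^ CARD('d)\<close>; hence boundary points with connection probability below
  \<open>\<delta>\<close> contribute less than \<open>p\<close> in total.\<close>

lemma connection_curve:
  fixes m :: nat
  defines "p \<equiv> critical_probability TYPE('d::finite)"
  defines "\<delta> \<equiv> p / real (3 * m) ^ CARD('d)"
  assumes "p < 1" "m \<ge> 1"
  obtains \<gamma> :: "nat \<Rightarrow> int ^ 'd" and T k where "0 < T" "\<gamma> 0 = 0" "\<bar>\<gamma> T $ k\<bar> = int m"
    "\<And>t. t \<le> T \<Longrightarrow> \<gamma> t \<in> lattice_box m \<and> \<delta> \<le> conn p (lattice_box m) 0 (\<gamma> t)"
    "\<And>t. t < T \<Longrightarrow> l1_dist (\<gamma> (Suc t)) (\<gamma> t) \<le> 1"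
proof -
  have p: "0 < p" "p \<le> 1"
    using critical_probability_pos[where 'd = 'd] assms by auto
  have m3: "1 \<le> real (3 * m) ^ CARD('d)"
    using assms(4) by (intro one_le_power) linarith
  have zero_box: "0 \<in> (lattice_box m :: (int ^ 'd) set)"
    by (simp add: lattice_box_iff)
  define S where "S = {y \<in> lattice_box m. \<delta> \<le> conn p (lattice_box m) 0 (y :: int ^ 'd)}"
  define W where "W = {y. joined_in S 0 y}"
  have "\<delta> \<le> p"
    using m3 p by (simp add: \<delta>_def divide_le_eq mult_le_cancel_left1)
  also have "p = p ^ card {0 :: int ^ 'd}"
    by simp
  also have "\<dots> \<le> conn p {0 :: int ^ 'd} 0 0"
    using p by (intro conn_ge_power_card joined_in_refl) auto
  also have "\<dots> \<le> conn p (lattice_box m :: (int ^ 'd) set) 0 0"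
    using p zero_box by (intro conn_mono) auto
  finally have "0 \<in> S"
    using zero_box by (simp add: S_def)
  then have W0: "0 \<in> W"
    by (simp add: W_def joined_in_refl)
  have "W \<subseteq> S"
    by (rule subsetI) (simp add: W_def joined_in_end)
  moreover have "S \<subseteq> lattice_box m"
    by (auto simp: S_def)
  ultimately have WS: "W \<subseteq> lattice_box m"
    by (rule order_trans)
  then have "finite W"
    by (rule finite_subset) simp
  have "\<exists>z\<in>W. \<exists>k. \<bar>z $ k\<bar> = int m"
  proof (rule ccontr)
    assume no: "\<not> (\<exists>z\<in>W. \<exists>k. \<bar>z $ k\<bar> = int m)"
    \<comment> \<open>If \<open>W\<close> misses the faces of the box, its boundary is still inside
      the box; a boundary vertex above the threshold would have been added to
      \<open>W\<close>.\<close>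
    have small: "y \<in> lattice_box m \<and> conn p (lattice_box m) 0 y < \<delta>" if y: "y \<in> outer_boundary W" for y
    proof -
      obtain v where v: "v \<in> W" "l1_dist v y \<le> 1" "y \<notin> W"
        using y by (auto simp: outer_boundary_def)
      have "y \<in> lattice_box m"
        unfolding lattice_box_iff
      proof
        fix i
        have "\<bar>v $ i\<bar> \<le> int m" "\<bar>v $ i\<bar> \<noteq> int m"
          using v no WS by (auto simp: lattice_box_iff)
        then show "\<bar>y $ i\<bar> \<le> int m"
          using component_le_l1_dist[of v i y] v by linarith
      qed
      moreover have "y \<notin> S"
        using v joined_in_step[of S 0 v y] by (auto simp: W_def l1_dist_commute)
      ultimately show ?thesis
        by (auto simp: S_def)
    qed
    have exit: "1 \<le> exit_mean p W"
      using exit_mean_critical[of W] assms W0 \<open>finite W\<close> by simp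
    \<comment> \<open>An empty sum is below 1; a boundary vertex is needed for the strict inequality
      of sums below.\<close>
    then have ne: "outer_boundary W \<noteq> {}"
      by (auto simp: exit_mean_def)
    \<comment> \<open>Opening \<open>y\<close> too, at the cost of a factor \<open>p\<close>, turns
      adjacency into a connection to \<open>y\<close>; its state is independent of those in
      \<open>W\<close>.\<close>
    have sub: "p * cyl p W (\<lambda>U. adjacent_to y (cluster U)) \<le> conn p (lattice_box m) 0 y"
      if y: "y \<in> outer_boundary W" for y
    proof -
      have "y \<notin> W"
        using y by (simp add: outer_boundary_def)
      have "cyl p W (\<lambda>U. adjacent_to y (cluster U)) \<le> cyl p W (\<lambda>U. joined_in (insert y U) 0 y)"
      proof (rule cyl_mono)
        fix U assume "adjacent_to y (cluster U)"
        then obtain v where v: "joined_in U 0 v" "l1_dist v y \<le> 1"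
          by (auto simp: adjacent_to_def cluster_def)
        have "joined_in (insert y U) 0 v"
          using v(1) by (rule joined_in_mono) auto
        then show "joined_in (insert y U) 0 y"
          by (rule joined_in_step) (use v(2) in \<open>auto simp: l1_dist_commute\<close>)
      qed (use p in auto)
      then have "p * cyl p W (\<lambda>U. adjacent_to y (cluster U)) \<le>
          p * cyl p W (\<lambda>U. joined_in (insert y U) 0 y) + (1 - p) * cyl p W (\<lambda>U. joined_in U 0 y)"
        using p by (intro add_increasing2 mult_left_mono mult_nonneg_nonneg cyl_nonneg) auto
      also have "\<dots> = conn p (insert y W) 0 y"
        unfolding conn_def using \<open>finite W\<close> \<open>y \<notin> W\<close> by (simp add: cyl_insert)
      also have "\<dots> \<le> conn p (lattice_box m) 0 y"
        using p WS small[OF y] by (intro conn_mono) auto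
      finally show ?thesis .
    qed
    have "p * 1 \<le> p * exit_mean p W"
      using exit p by (intro mult_left_mono) auto
    also have "\<dots> \<le> (\<Sum>y\<in>outer_boundary W. conn p (lattice_box m) 0 y)"
      unfolding exit_mean_def sum_distrib_left by (intro sum_mono sub)
    also have "\<dots> < (\<Sum>y\<in>outer_boundary W. \<delta>)"
      using small ne \<open>finite W\<close> by (intro sum_strict_mono) auto
    also have "\<dots> = real (card (outer_boundary W)) * \<delta>"
      by simp
    also have "\<dots> \<le> real (3 * m) ^ CARD('d) * \<delta>"
    proof (rule mult_right_mono)
      have "card (outer_boundary W) \<le> card (lattice_box m :: (int ^ 'd) set)"
        using small by (intro card_mono) auto
      also have "\<dots> \<le> (3 * m) ^ CARD('d)"
        unfolding card_lattice_box using assms(4) by (intro power_mono) auto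
      finally show "real (card (outer_boundary W)) \<le> real (3 * m) ^ CARD('d)"
        by (metis of_nat_le_iff of_nat_power)
      show "0 \<le> \<delta>"
        using p by (simp add: \<delta>_def)
    qed
    also have "\<dots> = p"
      using assms(4) by (simp add: \<delta>_def)
    finally show False by simp
  qed
  then obtain z k where z: "joined_in S 0 z" "\<bar>z $ k\<bar> = int m"
    by (auto simp: W_def)
  then obtain v where v: "lattice_path v" "hd v = 0" "last v = z" "set v \<subseteq> S"
    by (auto simp: joined_in_def)
  then have "v \<noteq> []"
    by (simp add: lattice_path_def)
  show thesis
  proof (rule that[of "length v - 1" "\<lambda>t. v ! t" k])
    show "0 < length v - 1"
    proof (rule ccontr)
      assume "\<not> 0 < length v - 1"
      then have "hd v = last v"
        using \<open>v \<noteq> []\<close> by (cases v) auto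
      then show False
        using v z assms(4) by auto
    qed
    show "v ! 0 = 0" "\<bar>v ! (length v - 1) $ k\<bar> = int m"
      using v z \<open>v \<noteq> []\<close> by (auto simp: hd_conv_nth last_conv_nth)
    show "v ! t \<in> lattice_box m \<and> \<delta> \<le> conn p (lattice_box m) 0 (v ! t)" if "t \<le> length v - 1" for t
    proof -
      have "t < length v"
        using that \<open>v \<noteq> []\<close> by (cases v) auto
      then have "v ! t \<in> S"
        using v(4) by auto
      then show ?thesis
        by (simp add: S_def)
    qed
    show "l1_dist (v ! Suc t) (v ! t) \<le> 1" if "t < length v - 1" for t
      using that v(1) by (simp add: lattice_path_def)
  qed
qed

text \<open>Signed coordinate permutations are isometries fixing the box and the origin, and the
  hypotheses provide one that maps \<open>a\<close> to \<open>w\<close>.\<close>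

lemma conn_box_symmetric:
  fixes a w :: "int ^ 'd::finite"
  assumes "bij \<pi>" "\<And>j. \<bar>w $ j\<bar> = \<bar>a $ \<pi> j\<bar>"
  shows "conn p (lattice_box m) 0 w = conn p (lattice_box m) 0 a"
proof -
  define s where "s j = (if w $ j = a $ \<pi> j then 1 else - 1 :: int)" for j
  have s: "s j * s j = 1" "\<bar>s j\<bar> = 1" for j
    by (auto simp: s_def)
  define f where "f x = (\<chi> j. s j * x $ \<pi> j)" for x :: "int ^ 'd"
  define g where "g y = (\<chi> i. s (inv \<pi> i) * y $ inv \<pi> i)" for y :: "int ^ 'd"
  have inv: "inv \<pi> (\<pi> j) = j" "\<pi> (inv \<pi> j) = j" for j
    using assms(1) by (auto simp: bij_is_inj bij_is_surj surj_f_inv_f)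
  have fg: "f (g y) = y" "g (f y) = y" for y
    by (simp_all add: f_def g_def vec_eq_iff inv s(1) mult.assoc[symmetric])
  have "bij f"
    by (rule o_bij[of g]) (auto simp: fg fun_eq_iff)
  have iso: "l1_dist (f x) (f y) = l1_dist x y" for x y
  proof -
    have "l1_dist (f x) (f y) = (\<Sum>j\<in>UNIV. \<bar>x $ \<pi> j - y $ \<pi> j\<bar>)"
      by (simp add: l1_dist_def f_def right_diff_distrib[symmetric] abs_mult s)
    also have "\<dots> = l1_dist x y"
      unfolding l1_dist_def using assms(1) by (rule sum.reindex_bij_betw)
    finally show ?thesis .
  qed
  have "f ` lattice_box m = lattice_box m"
  proof (intro equalityI subsetI)
    fix y :: "int ^ 'd" assume "y \<in> lattice_box m"
    then have "g y \<in> lattice_box m"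
      by (simp add: lattice_box_iff g_def abs_mult s)
    then show "y \<in> f ` lattice_box m"
      by (rule rev_image_eqI) (simp add: fg)
  qed (auto simp: lattice_box_iff f_def abs_mult s)
  moreover have "f 0 = 0"
    by (simp add: f_def vec_eq_iff)
  moreover have "f a = w"
  proof -
    have "s j * a $ \<pi> j = w $ j" for j
      using assms(2)[of j] by (auto simp: s_def abs_eq_iff)
    then show ?thesis
      by (simp add: f_def vec_eq_iff)
  qed
  ultimately show ?thesis
    using conn_image[OF iso \<open>bij f\<close>, of p "lattice_box m" 0 a] by simp
qed

section \<open>A discrete Poincare--Miranda argument\<close>

text \<open>Each step has prescribed size \<open>b i\<close> and is directed towards the origin, so that the walk never
  leaves an interval containing the start and all step sizes; its absolute value depends
  continuously on the step sizes although the directions do not.\<close>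

primrec homing_walk :: "(nat \<Rightarrow> int) \<Rightarrow> int \<Rightarrow> nat \<Rightarrow> int" where
  "homing_walk b a 0 = a"
| "homing_walk b a (Suc i) =
     (if 0 \<le> homing_walk b a i then homing_walk b a i - b i else homing_walk b a i + b i)"

lemma abs_homing_walk_Suc:
  "\<bar>homing_walk b a (Suc i)\<bar> = \<bar>\<bar>homing_walk b a i\<bar> - b i\<bar>"
  by auto

lemma abs_homing_walk_le:
  assumes "\<bar>a\<bar> \<le> m" "\<And>k. k < i \<Longrightarrow> 0 \<le> b k \<and> b k \<le> m"
  shows "\<bar>homing_walk b a i\<bar> \<le> m"
  using assms(2)
proof (induction i)
  case (Suc i)
  then have "\<bar>homing_walk b a i\<bar> \<le> m" "0 \<le> b i" "b i \<le> m"
    by auto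
  then show ?case
    unfolding abs_homing_walk_Suc by linarith
qed (use assms(1) in auto)

lemma abs_homing_walk_diff_le:
  "\<bar>\<bar>homing_walk b a i\<bar> - \<bar>homing_walk b' a i\<bar>\<bar> \<le> (\<Sum>k<i. \<bar>b k - b' k\<bar>)"
proof (induction i)
  case (Suc i)
  then show ?case
    unfolding abs_homing_walk_Suc sum.lessThan_Suc by linarith
qed simp

text \<open>The curve \<open>h j j\<close> sweeps from \<open>0\<close> to \<open>m\<close>, whereas the final distance
  from the origin of the \<open>j\<close>-th walk, driven by the other curves, stays between \<open>0\<close> and \<open>m\<close>.\<close>

lemma balanced_times:
  fixes h :: "nat \<Rightarrow> nat \<Rightarrow> nat \<Rightarrow> int" and a :: "nat \<Rightarrow> int"
  assumes T: "0 < T"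
    and h_bounds: "\<And>i j t. i < d \<Longrightarrow> j < d \<Longrightarrow> t \<le> T \<Longrightarrow> 0 \<le> h i j t \<and> h i j t \<le> m"
    and h_start: "\<And>i j. h i j 0 = 0"
    and h_step: "\<And>i j t. t < T \<Longrightarrow> \<bar>h i j (Suc t) - h i j t\<bar> \<le> 1"
    and h_end: "\<And>i. i < d \<Longrightarrow> h i i T = m"
    and a: "\<And>j. j < d \<Longrightarrow> \<bar>a j\<bar> \<le> m"
  obtains t where "\<And>j. j < d \<Longrightarrow> t j \<le> T"
    "\<And>j. j < d \<Longrightarrow>
       \<bar>h j j (t j) - \<bar>homing_walk (\<lambda>i. if i = j then 0 else h i j (t i)) (a j) d\<bar>\<bar> \<le> int d"
proof -
  \<comment> \<open>Curve \<open>j\<close> is masked in coordinate \<open>j\<close>: its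
    contribution there has to balance the others.\<close>
  define N where "N t j = (\<lambda>i. if i = j then 0 else h i j (t i))" for t j
  define H where "H t j = h j j (t j) - \<bar>homing_walk (N t j) (a j) d\<bar>" for t j
  \<comment> \<open>Kuhn's lemma prescribes the labels at times 0 and \<open>T\<close>; in between
    the label records the sign of \<open>H\<close>.\<close>
  define label where "label t j = (if t j = 0 then 0 else if t j = T then 1 else if H t j < 0 then 0 else 1 :: nat)"
    for t :: "nat \<Rightarrow> nat" and j
  have h_close: "\<bar>h i j r - h i j q\<bar> \<le> 1" if "q \<le> r" "r \<le> q + 1" "q < T" for i j q r
    using that h_step[of q i j] by (cases "r = q") (auto dest: le_antisym simp: le_Suc_eq)
  \<comment> \<open>One unit of error for each of the \<open>d\<close> curves.\<close>
  have H_close: "\<bar>H r j - H q j\<bar> \<le> int d"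
    if q: "\<And>i. i < d \<Longrightarrow> q i < T \<and> q i \<le> r i \<and> r i \<le> q i + 1" and "j < d" for q r j
  proof -
    have "\<bar>H r j - H q j\<bar> \<le> \<bar>h j j (r j) - h j j (q j)\<bar> + (\<Sum>k<d. \<bar>N r j k - N q j k\<bar>)"
      unfolding H_def using abs_homing_walk_diff_le[of "N r j" "a j" d "N q j"] by linarith
    also have "(\<Sum>k<d. \<bar>N r j k - N q j k\<bar>) = (\<Sum>k\<in>{..<d} - {j}. \<bar>h k j (r k) - h k j (q k)\<bar>)"
      by (intro sum.mono_neutral_cong_right) (auto simp: N_def)
    also have "\<bar>h j j (r j) - h j j (q j)\<bar> + \<dots> = (\<Sum>k<d. \<bar>h k j (r k) - h k j (q k)\<bar>)"
      using \<open>j < d\<close> by (intro sum.remove[symmetric]) auto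
    also have "\<dots> \<le> (\<Sum>k<d. 1)"
      using q by (intro sum_mono h_close) auto
    finally show ?thesis by simp
  qed
  have walk_le: "\<bar>homing_walk (N t j) (a j) d\<bar> \<le> m" if "\<And>i. i < d \<Longrightarrow> t i \<le> T" "j < d" for t j
  proof (rule abs_homing_walk_le)
    fix k assume "k < d"
    then show "0 \<le> N t j k \<and> N t j k \<le> m"
      using that h_bounds[of k j "t k"] h_bounds[of k j 0] by (auto simp: N_def)
  qed (use a that in auto)
  \<comment> \<open>The prescribed labels agree with the sign of \<open>H\<close>: there
    \<open>h j j\<close> is 0 or \<open>m\<close>, and the distance of the walk lies
    between.\<close>
  have sign: "label t j = 0 \<Longrightarrow> H t j \<le> 0" "label t j \<noteq> 0 \<Longrightarrow> 0 \<le> H t j"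
    if "\<And>i. i < d \<Longrightarrow> t i \<le> T" "j < d" for t j
    using walk_le[of t j] that h_start[of j j] h_end[of j] by (auto simp: label_def H_def split: if_splits)
  have labels: "\<forall>x. (\<forall>i<d. x i \<le> T) \<longrightarrow> (\<forall>i<d. label x i = 0 \<or> label x i = 1)"
    "\<forall>x. (\<forall>i<d. x i \<le> T) \<longrightarrow> (\<forall>i<d. x i = 0 \<longrightarrow> label x i = 0)"
    "\<forall>x. (\<forall>i<d. x i \<le> T) \<longrightarrow> (\<forall>i<d. x i = T \<longrightarrow> label x i = 1)"
    unfolding label_def using T by simp_all
  \<comment> \<open>A unit cube at \<open>q\<close> that has, for every coordinate, two corners with
    different labels.\<close>
  obtain q where q: "\<forall>i<d. q i < T" and
    rs: "\<forall>i<d. \<exists>r s. (\<forall>j<d. q j \<le> r j \<and> r j \<le> q j + 1) \<and> (\<forall>j<d. q j \<le> s j \<and> s j \<le> q j + 1) \<and> label r i \<noteq> label s i"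
    by (rule kuhn_lemma[OF T labels])
  show thesis
  proof (rule that[of q])
    fix j assume j: "j < d"
    then show "q j \<le> T"
      using q by auto
    obtain r s where "\<forall>j<d. q j \<le> r j \<and> r j \<le> q j + 1" "\<forall>j<d. q j \<le> s j \<and> s j \<le> q j + 1"
      and "label r j \<noteq> label s j"
      using rs j by blast
    moreover have "label r j = 0 \<or> label s j = 0"
      using \<open>label r j \<noteq> label s j\<close> by (auto simp: label_def split: if_splits)
    ultimately obtain r s where r: "\<And>i. i < d \<Longrightarrow> q i \<le> r i \<and> r i \<le> q i + 1"
      and s: "\<And>i. i < d \<Longrightarrow> q i \<le> s i \<and> s i \<le> q i + 1" and "label r j = 0" "label s j \<noteq> 0"
      by metis
    have le: "r i \<le> T" "s i \<le> T" if "i < d" for i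
      using r[OF that] s[OF that] q that by fastforce+
    have "H r j \<le> 0" "0 \<le> H s j"
      using sign(1)[of r j] sign(2)[of s j] le j \<open>label r j = 0\<close> \<open>label s j \<noteq> 0\<close> by auto
    moreover have "\<bar>H r j - H q j\<bar> \<le> int d" "\<bar>H s j - H q j\<bar> \<le> int d"
      using H_close[of q r j] H_close[of q s j] r s q j by auto
    \<comment> \<open>\<open>H q j\<close> is within \<open>d\<close> of a nonpositive and of a
      nonnegative value.\<close>
    ultimately have "\<bar>H q j\<bar> \<le> int d" by linarith
    then show "\<bar>h j j (q j) - \<bar>homing_walk (\<lambda>i. if i = j then 0 else h i j (q i)) (a j) d\<bar>\<bar> \<le> int d"
      by (simp add: H_def N_def)
  qed
qed

text \<open>Coordinate \<open>j\<close> follows its homing walk, with the move of curve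
  \<open>j\<close> itself inserted at step \<open>j\<close>. The bound \<open>2 * m\<close> is
  \<open>m\<close> for the walk plus \<open>m\<close> for that move.\<close>

lemma signed_decomposition:
  fixes h :: "nat \<Rightarrow> nat \<Rightarrow> nat \<Rightarrow> int" and a :: "nat \<Rightarrow> int"
  assumes "0 < T"
    and h_bounds: "\<And>i j t. i < d \<Longrightarrow> j < d \<Longrightarrow> t \<le> T \<Longrightarrow> 0 \<le> h i j t \<and> h i j t \<le> m"
    and "\<And>i j. h i j 0 = 0"
    and "\<And>i j t. t < T \<Longrightarrow> \<bar>h i j (Suc t) - h i j t\<bar> \<le> 1"
    and "\<And>i. i < d \<Longrightarrow> h i i T = m"
    and a: "\<And>j. j < d \<Longrightarrow> \<bar>a j\<bar> \<le> m"
  obtains t z where "\<And>j. j < d \<Longrightarrow> t j \<le> T" "\<And>j. j < d \<Longrightarrow> z 0 j = a j"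
    "\<And>i j. i < d \<Longrightarrow> j < d \<Longrightarrow> \<bar>z (Suc i) j - z i j\<bar> = h i j (t i)"
    "\<And>i j. i \<le> d \<Longrightarrow> j < d \<Longrightarrow> \<bar>z i j\<bar> \<le> 2 * m"
    "\<And>j. j < d \<Longrightarrow> \<bar>z d j\<bar> \<le> int d"
proof -
  obtain t where t: "\<And>j. j < d \<Longrightarrow> t j \<le> T"
    "\<And>j. j < d \<Longrightarrow>
       \<bar>h j j (t j) - \<bar>homing_walk (\<lambda>i. if i = j then 0 else h i j (t i)) (a j) d\<bar>\<bar> \<le> int d"
    using balanced_times[of T d h m a] assms by blast
  define c where "c j = homing_walk (\<lambda>i. if i = j then 0 else h i j (t i)) (a j)" for j
  \<comment> \<open>The direction of the inserted move looks ahead to the final position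
    \<open>c j d\<close>, so that \<open>\<bar>z d j\<bar>\<close> is the imbalance bounded in
    \<open>t(2)\<close>.\<close>
  define z where "z i j = c j i - (if j < i then (if 0 \<le> c j d then h j j (t j) else - h j j (t j)) else 0)" for i j
  have hb: "0 \<le> h i j (t i) \<and> h i j (t i) \<le> m" if "i < d" "j < d" for i j
    using h_bounds[OF that] t(1)[OF that(1)] by simp
  have c_le: "\<bar>c j i\<bar> \<le> m" if "i \<le> d" "j < d" for i j
    unfolding c_def
  proof (rule abs_homing_walk_le)
    fix k assume "k < i"
    then show "0 \<le> (if k = j then 0 else h k j (t k)) \<and> (if k = j then 0 else h k j (t k)) \<le> m"
      using hb[of k j] that a[of j] by auto
  qed (use a that in auto)
  show thesis
  proof (rule that[of t z])
    show "z 0 j = a j" for j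
      by (simp add: z_def c_def)
    show "\<bar>z (Suc i) j - z i j\<bar> = h i j (t i)" if "i < d" "j < d" for i j
    proof (cases "i = j")
      case True
      then have "c j (Suc i) = c j i" by (simp add: c_def)
      then show ?thesis using True hb[OF that] by (simp add: z_def)
    next
      case False
      then have "c j (Suc i) = (if 0 \<le> c j i then c j i - h i j (t i) else c j i + h i j (t i))"
        by (simp add: c_def)
      moreover have "j < Suc i \<longleftrightarrow> j < i"
        using False by auto
      ultimately show ?thesis using hb[OF that] by (simp add: z_def)
    qed
    show "\<bar>z i j\<bar> \<le> 2 * m" if "i \<le> d" "j < d" for i j
      using c_le[OF that] hb[OF that(2) that(2)] by (auto simp: z_def)
    show "\<bar>z d j\<bar> \<le> int d" if "j < d" for j
      using t(2)[OF that] that by (auto simp: z_def c_def split: if_splits)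
  qed (use t in auto)
qed

section \<open>Combining the steps\<close>

text \<open>Opening a whole box settles bounded \<open>n\<close>, and also \<open>p = 1\<close>,
  where all powers are 1.\<close>

lemma conn_small_or_trivial:
  fixes x y :: "int ^ 'd::finite"
  assumes "0 \<le> p" "p \<le> 1" "x \<in> lattice_box n" "y \<in> lattice_box n" "n \<le> N" "n \<le> r \<or> p = 1"
  shows "p ^ card (lattice_box r :: (int ^ 'd) set) \<le> conn p (lattice_box N) x y"
proof -
  have "p ^ card (lattice_box r :: (int ^ 'd) set) \<le> p ^ card (lattice_box n :: (int ^ 'd) set)"
    using assms(6)
  proof
    assume "n \<le> r"
    then show ?thesis
      using assms by (intro power_decreasing card_mono lattice_box_mono) auto
  qed simp
  also have "\<dots> \<le> conn p (lattice_box n) x y"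
    using assms by (intro conn_ge_power_card lattice_box_joined_in) auto
  also have "\<dots> \<le> conn p (lattice_box N) x y"
    using assms by (intro conn_mono lattice_box_mono) auto
  finally show ?thesis .
qed

text \<open>The curves have scale \<open>2 * n\<close> because the entries of \<open>y - x\<close>
  are at most that large. The \<open>CARD('d)\<close> steps lead from \<open>y\<close> to within sup
  distance \<open>CARD('d)\<close> of \<open>x\<close>; opening a box of fixed size closes this
  gap.\<close>

lemma conn_large:
  fixes x y :: "int ^ 'd::finite" and n :: nat
  defines "p \<equiv> critical_probability TYPE('d)"
  assumes "p < 1" "n \<ge> 1" "CARD('d) \<le> n" and xy: "x \<in> lattice_box n" "y \<in> lattice_box n"
  shows "(p / real (6 * n) ^ CARD('d)) ^ CARD('d) * p ^ card (lattice_box CARD('d) :: (int ^ 'd) set)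
    \<le> conn p (lattice_box (9 * n)) x y"
proof -
  define D where "D = CARD('d)"
  define \<delta> where "\<delta> = p / real (6 * n) ^ CARD('d)"
  let ?B = "lattice_box (9 * n) :: (int ^ 'd) set"
  have p: "0 < p" "p \<le> 1"
    using critical_probability_pos[where 'd = 'd] assms by auto
  have hyps: "p < 1" "1 \<le> 2 * n" and six: "3 * (2 * n) = 6 * n"
    using assms by simp_all
  obtain \<gamma> :: "nat \<Rightarrow> int ^ 'd" and T k where \<gamma>: "0 < T" "\<gamma> 0 = 0" "\<bar>\<gamma> T $ k\<bar> = int (2 * n)"
    "\<And>t. t \<le> T \<Longrightarrow> \<gamma> t \<in> lattice_box (2 * n) \<and> \<delta> \<le> conn p (lattice_box (2 * n)) 0 (\<gamma> t)"
    "\<And>t. t < T \<Longrightarrow> l1_dist (\<gamma> (Suc t)) (\<gamma> t) \<le> 1"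
    by (rule connection_curve[where 'd = 'd and m = "2 * n", folded p_def, OF hyps, unfolded six, folded \<delta>_def])
      (rule that)
  obtain e where e: "bij_betw e {0..<D} (UNIV :: 'd set)"
    using ex_bij_betw_nat_finite[of "UNIV :: 'd set"] by (auto simp: D_def)
  define e' where "e' = inv_into {0..<D} e"
  have e': "e' l < D" "e (e' l) = l" for l
    using bij_betw_inv_into_right[OF e] bij_betwE[OF bij_betw_inv_into[OF e]] by (auto simp: e'_def)
  have e'_e: "e' (e j) = j" if "j < D" for j
    using bij_betw_inv_into_left[OF e] that by (simp add: e'_def)
  \<comment> \<open>Swapping \<open>e i\<close> and \<open>k\<close> makes coordinate
    \<open>e i\<close> the one that reaches \<open>2 * n\<close>.\<close>
  define h where "h i j t = \<bar>\<gamma> t $ Transposition.transpose (e i) k (e j)\<bar>" for i j t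
  obtain t z where t: "\<And>j. j < D \<Longrightarrow> t j \<le> T" and z: "\<And>j. j < D \<Longrightarrow> z 0 j = (y - x) $ e j"
    "\<And>i j. i < D \<Longrightarrow> j < D \<Longrightarrow> \<bar>z (Suc i) j - z i j\<bar> = h i j (t i)"
    "\<And>i j. i \<le> D \<Longrightarrow> j < D \<Longrightarrow> \<bar>z i j\<bar> \<le> 2 * int (2 * n)"
    "\<And>j. j < D \<Longrightarrow> \<bar>z D j\<bar> \<le> int D"
  proof (rule signed_decomposition[of T D h "int (2 * n)" "\<lambda>j. (y - x) $ e j"])
    show "0 \<le> h i j s \<and> h i j s \<le> int (2 * n)" if "s \<le> T" for i j s
      using \<gamma>(4)[OF that] unfolding h_def lattice_box_iff by simp
    show "\<bar>h i j (Suc s) - h i j s\<bar> \<le> 1" if "s < T" for i j s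
      using \<gamma>(5)[OF that] component_le_l1_dist[of "\<gamma> (Suc s)" _ "\<gamma> s"] unfolding h_def
      by (meson abs_triangle_ineq3 order_trans)
    show "\<bar>(y - x) $ e j\<bar> \<le> int (2 * n)" for j
    proof -
      have "\<bar>x $ e j\<bar> \<le> int n" "\<bar>y $ e j\<bar> \<le> int n"
        using xy by (auto simp: lattice_box_iff)
      then show ?thesis by simp
    qed
  qed (use \<gamma> in \<open>auto simp: h_def\<close>)
  \<comment> \<open>\<open>z i\<close> is the displacement from \<open>x\<close> that is left after
    \<open>i\<close> steps.\<close>
  define u where "u i = x + (\<chi> l. z i (e' l))" for i
  have u0: "u 0 = y"
    using z(1)[OF e'(1)] by (simp add: u_def vec_eq_iff e'(2))
  have in_box: "\<bar>x $ l\<bar> \<le> int n" for l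
    using xy by (simp add: lattice_box_iff)
  have step_le: "\<delta> \<le> conn p ?B (u (Suc i)) (u i)" if i: "i < D" for i
  proof -
    define w where "w = u (Suc i) - u i"
    have "\<bar>w $ l\<bar> = \<bar>\<gamma> (t i) $ Transposition.transpose (e i) k l\<bar>" for l
      using z(2)[OF i e'(1)[of l]] by (simp add: w_def u_def h_def e'(2))
    then have "conn p (lattice_box (2 * n)) 0 w = conn p (lattice_box (2 * n)) 0 (\<gamma> (t i))"
      by (intro conn_box_symmetric) auto
    then have "\<delta> \<le> conn p (lattice_box (2 * n)) 0 w"
      using \<gamma>(4)[OF t[OF i]] by simp
    also have "\<dots> = conn p ((+) (u i) ` lattice_box (2 * n)) (u i) (u (Suc i))"
      using conn_translate[of p "u i" "lattice_box (2 * n)" 0 w] by (simp add: w_def)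
    also have "\<dots> \<le> conn p ?B (u i) (u (Suc i))"
    proof (rule conn_mono)
      show "(+) (u i) ` lattice_box (2 * n) \<subseteq> ?B"
      proof
        fix v assume "v \<in> (+) (u i) ` lattice_box (2 * n)"
        then obtain b where b: "v = u i + b" "b \<in> lattice_box (2 * n)" by blast
        show "v \<in> ?B"
          unfolding lattice_box_iff
        proof
          fix l
          \<comment> \<open>The bounds \<open>n\<close> for \<open>x\<close>, \<open>4 * n\<close>
            for \<open>z i\<close> and \<open>2 * n\<close> for \<open>b\<close> add up to
            \<open>7 * n\<close>.\<close>
          have "\<bar>b $ l\<bar> \<le> 2 * int n"
            using b(2) by (simp add: lattice_box_iff)
          moreover have "\<bar>z i (e' l)\<bar> \<le> 4 * int n"
            using z(3)[of i "e' l"] i e'(1)[of l] by simp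
          ultimately show "\<bar>v $ l\<bar> \<le> int (9 * n)"
            using in_box[of l] by (simp add: b(1) u_def)
        qed
      qed
    qed (use p in auto)
    finally show ?thesis
      by (simp add: conn_commute)
  qed
  have "p ^ card (lattice_box D :: (int ^ 'd) set) \<le> conn p (lattice_box D) 0 (\<chi> l. z D (e' l))"
    using p z(4) e'(1) by (intro conn_ge_power_card lattice_box_joined_in) (auto simp: lattice_box_iff)
  also have "\<dots> = conn p ((+) x ` lattice_box D) x (u D)"
    using conn_translate[of p x "lattice_box D" 0] by (simp add: u_def)
  also have "\<dots> \<le> conn p ?B x (u D)"
  proof (rule conn_mono)
    show "(+) x ` lattice_box D \<subseteq> ?B"
    proof
      fix v assume "v \<in> (+) x ` lattice_box D"
      then obtain b where b: "v = x + b" "b \<in> lattice_box D" by blast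
      show "v \<in> ?B"
        unfolding lattice_box_iff
      proof
        fix l
        have "\<bar>b $ l\<bar> \<le> int D"
          using b(2) by (simp add: lattice_box_iff)
        then show "\<bar>v $ l\<bar> \<le> int (9 * n)"
          using in_box[of l] \<open>CARD('d) \<le> n\<close> by (simp add: b(1) D_def)
      qed
    qed
  qed (use p in auto)
  finally have last: "p ^ card (lattice_box D :: (int ^ 'd) set) \<le> conn p ?B x (u D)" .
  have \<delta>: "0 \<le> \<delta>"
    using p by (simp add: \<delta>_def)
  \<comment> \<open>The chain is assembled backwards from \<open>u D\<close> to
    \<open>u 0 = y\<close>, one factor \<open>\<delta>\<close> per step.\<close>
  have "\<delta> ^ (D - i) * p ^ card (lattice_box D :: (int ^ 'd) set) \<le> conn p ?B x (u i)" if "i \<le> D" for i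
    using that
  proof (induction i rule: inc_induct)
    case base
    then show ?case using last by simp
  next
    case (step i)
    have "\<delta> ^ (D - i) * p ^ card (lattice_box D :: (int ^ 'd) set) =
        (\<delta> ^ (D - Suc i) * p ^ card (lattice_box D :: (int ^ 'd) set)) * \<delta>"
      using step.hyps by (simp add: Suc_diff_Suc[symmetric])
    also have "\<dots> \<le> conn p ?B x (u (Suc i)) * conn p ?B (u (Suc i)) (u i)"
      using step.IH step_le[of i] step.hyps \<delta> p
      by (intro mult_mono) (auto simp: conn_def cyl_nonneg)
    also have "\<dots> \<le> conn p ?B x (u i)"
      using p by (intro conn_trans) auto
    finally show ?case .
  qed
  from this[of 0] show ?thesis
    by (simp add: u0 D_def \<delta>_def)
qed

theorem corollary1p2:
  assumes "CARD('d::finite) \<ge> 2"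
  shows "\<exists>c'>0. \<forall>n\<ge>1. \<forall>x\<in>lattice_box n. \<forall>y\<in>lattice_box n.
           measure (site_percolation (critical_probability TYPE('d)))
             (connection_event x (y :: int ^ 'd) (lattice_box (9 * n)))
           \<ge> c' / real n ^ (CARD('d)\<^sup>2)"
proof -
  define p where "p = critical_probability TYPE('d)"
  define D where "D = CARD('d)"
  define K where "K = card (lattice_box D :: (int ^ 'd) set)"
  \<comment> \<open>What is left of the bound for large \<open>n\<close> once the power
    \<open>D * D\<close> of \<open>n\<close> is split off.\<close>
  define c where "c = (p / 6 ^ D) ^ D * p ^ K"
  have p: "0 < p" "p \<le> 1"
    using critical_probability_pos critical_probability_le_1 by (auto simp: p_def)
  have c: "0 < c" "c \<le> p ^ K"
  proof -
    show "0 < c"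
      using p by (simp add: c_def)
    have "p \<le> 6 ^ D"
      by (rule order_trans[OF p(2) one_le_power]) simp
    then have "p / 6 ^ D \<le> 1"
      by (simp add: divide_le_eq)
    then have "(p / 6 ^ D) ^ D \<le> 1"
      using p by (intro power_le_one) auto
    then show "c \<le> p ^ K"
      using p by (simp add: c_def mult_left_le_one_le)
  qed
  have "c / real n ^ D\<^sup>2 \<le> conn p (lattice_box (9 * n)) x y"
    if n: "n \<ge> 1" and xy: "x \<in> lattice_box n" "y \<in> lattice_box n" for n and x y :: "int ^ 'd"
  proof (cases "D \<le> n \<and> p < 1")
    case True
    have "c / real n ^ D\<^sup>2 = (p / real (6 * n) ^ D) ^ D * p ^ K"
      by (simp add: c_def power_divide power_mult_distrib power2_eq_square power_mult)
    also have "\<dots> \<le> conn p (lattice_box (9 * n)) x y"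
      using conn_large[of n x y] True n xy by (simp add: p_def D_def K_def)
    finally show ?thesis .
  next
    case False
    \<comment> \<open>For \<open>n < D\<close> or \<open>p = 1\<close> the constant bound
      \<open>p ^ K\<close> suffices.\<close>
    have "c / real n ^ D\<^sup>2 \<le> c / 1"
      using n c by (intro divide_left_mono one_le_power) auto
    also have "\<dots> \<le> p ^ K"
      using c by simp
    also have "\<dots> \<le> conn p (lattice_box (9 * n)) x y"
      unfolding K_def using False p xy by (intro conn_small_or_trivial[of p x n y]) auto
    finally show ?thesis .
  qed
  then have "\<forall>n\<ge>1. \<forall>x\<in>lattice_box n. \<forall>y\<in>lattice_box n.
      measure (site_percolation p) (connection_event x (y :: int ^ 'd) (lattice_box (9 * n))) \<ge> c / real n ^ D\<^sup>2"
    using p by (simp add: measure_connection_event)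
  then show ?thesis
    using c(1) unfolding p_def D_def by blast
qed

end
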